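(* Let $q$ be an odd prime power, $n=2t$ with $t\geq 5$, let $\sigma$ be a generator of $\mathrm{Gal}(\mathbb{F}_{q^n}/\mathbb{F}_q)$, let $h,k\in\mathbb{F}_{q^n}$ satisfy $\mathrm{N}_{q^n/q^t}(h)=\mathrm{N}_{q^n/q^t}(k)=-1$, and let $s$ be an integer (considered modulo $n$) coprime to $n$. If $s\notin\{1,-1,t-1,t+1\}$ (modulo $n$), then $\mathcal{C}_{h,t,\sigma}$ and $\mathcal{C}_{k,t,\sigma^s}$ are not equivalent.
   Context: $\mathrm{N}_{q^n/q^t}(h)=h^{q^t+1}=h\,\sigma^t(h)$ is the norm from $\mathbb{F}_{q^n}$ to $\mathbb{F}_{q^t}$. For a generator $\sigma$ of $\mathrm{Gal}(\mathbb{F}_{q^n}/\mathbb{F}_q)$, $\mathcal{L}_{n,q}$ denotes the ring (under addition and composition) of $\sigma$-polynomials $f(x)=\sum_{i=0}^{n-1}f_ix^{\sigma^i}$, $f_i\in\mathbb{F}_{q^n}$, each identified with the $\mathbb{F}_q$-endomorphism $\alpha\mapsto\sum_i f_i\sigma^i(\alpha)$ of $\mathbb{F}_{q^n}$; thus $\mathcal{L}_{n,q}\cong\mathrm{End}_{\mathbb{F}_q}(\mathbb{F}_{q^n})$, independently of $\sigma$. $\langle\cdot\rangle_{\mathbb{F}_{q^n}}$ denotes the span with respect to left multiplication by scalars of $\mathbb{F}_{q^n}$. A rank-metric code is a subset of $\mathcal{L}_{n,q}$. Two rank-metric codes $\mathcal{C}_1,\mathcal{C}_2\subseteq\mathcal{L}_{n,q}$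 are equivalent if there exist invertible $f_1,f_2\in\mathcal{L}_{n,q}$ and a field automorphism $\rho\in\mathrm{Aut}(\mathbb{F}_{q^n})$ with $\mathcal{C}_1=\{f_1\circ g^{\rho}\circ f_2: g\in\mathcal{C}_2\}$, where $g^{\rho}(x)=\sum_i\rho(a_i)x^{\sigma^i}$ if $g(x)=\sum_i a_ix^{\sigma^i}$. For any generator $\tau$ of $\mathrm{Gal}(\mathbb{F}_{q^n}/\mathbb{F}_q)$ and any $h\in\mathbb{F}_{q^n}$ with $\mathrm{N}_{q^n/q^t}(h)=-1$, $\mathcal{C}_{h,t,\tau}=\langle x,\psi_{h,t,\tau}(x)\rangle_{\mathbb{F}_{q^n}}$, where $\psi_{h,t,\tau}(x)=x^{\tau}+x^{\tau^{t-1}}+h\tau(h)x^{\tau^{t+1}}+h\tau^{-1}(h^{-1})x^{\tau^{2t-1}}$. *)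

theory Defs
  imports "HOL-Number_Theory.Prime_Powers" "HOL-Number_Theory.Cong" "HOL-Library.Cardinality" "HOL-Library.Function_Algebras"
begin

(* The field F_{q^n} is a type 'a :: {field, finite} with q^n elements; F_q is its subfield with
   q elements, given as a set K. *)

definition is_subfield :: "'a::field set \<Rightarrow> bool" where
  "is_subfield K \<longleftrightarrow> 0 \<in> K \<and> 1 \<in> K \<and>
     (\<forall>x\<in>K. \<forall>y\<in>K. x + y \<in> K \<and> x * y \<in> K) \<and> (\<forall>x\<in>K. - x \<in> K \<and> inverse x \<in> K)"

definition field_aut :: "('a::field \<Rightarrow> 'a) \<Rightarrow> bool" where
  "field_aut \<rho> \<longleftrightarrow> bij \<rho> \<and> \<rho> 1 = 1 \<and> (\<forall>x y. \<rho> (x + y) = \<rho> x + \<rho> y \<and> \<rho> (x * y) = \<rho> x * \<rho> y)"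

definition Gal :: "'a::field set \<Rightarrow> ('a \<Rightarrow> 'a) set" where
  "Gal K = {\<tau>. field_aut \<tau> \<and> (\<forall>x\<in>K. \<tau> x = x)}"

(* Integer powers with respect to composition; meant for bijections. *)
definition int_iter :: "('a \<Rightarrow> 'a) \<Rightarrow> int \<Rightarrow> 'a \<Rightarrow> 'a" where
  "int_iter \<tau> s = (if 0 \<le> s then \<tau> ^^ nat s else inv \<tau> ^^ nat (- s))"

definition generates_Gal :: "'a::field set \<Rightarrow> ('a \<Rightarrow> 'a) \<Rightarrow> bool" where
  "generates_Gal K \<tau> \<longleftrightarrow> \<tau> \<in> Gal K \<and> Gal K = range (int_iter \<tau>)"

(* The sigma-polynomial with coefficients a 0, ..., a (n-1), identified with the map it induces. *)
definition sigma_poly :: "nat \<Rightarrow> ('a::field \<Rightarrow> 'a) \<Rightarrow> (nat \<Rightarrow> 'a) \<Rightarrow> 'a \<Rightarrow> 'a" where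
  "sigma_poly n \<sigma> a = (\<lambda>x. \<Sum>i<n. a i * (\<sigma> ^^ i) x)"

definition sigma_polys :: "nat \<Rightarrow> ('a::field \<Rightarrow> 'a) \<Rightarrow> ('a \<Rightarrow> 'a) set" where
  "sigma_polys n \<sigma> = range (sigma_poly n \<sigma>)"

definition invertible_poly :: "nat \<Rightarrow> ('a::field \<Rightarrow> 'a) \<Rightarrow> ('a \<Rightarrow> 'a) \<Rightarrow> bool" where
  "invertible_poly n \<sigma> f \<longleftrightarrow>
     f \<in> sigma_polys n \<sigma> \<and> (\<exists>g\<in>sigma_polys n \<sigma>. f \<circ> g = id \<and> g \<circ> f = id)"

(* A codeword g is written as sigma_poly n \<sigma> a, so that g^rho is sigma_poly n \<sigma> (\<rho> \<circ> a).
   Codes are understood to be subsets of sigma_polys n \<sigma>. *)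
definition codes_equivalent ::
  "nat \<Rightarrow> ('a::field \<Rightarrow> 'a) \<Rightarrow> ('a \<Rightarrow> 'a) set \<Rightarrow> ('a \<Rightarrow> 'a) set \<Rightarrow> bool" where
  "codes_equivalent n \<sigma> C1 C2 \<longleftrightarrow>
     (\<exists>f1 f2 \<rho>. invertible_poly n \<sigma> f1 \<and> invertible_poly n \<sigma> f2 \<and> field_aut \<rho> \<and>
        C1 = {f1 \<circ> sigma_poly n \<sigma> (\<rho> \<circ> a) \<circ> f2 | a. sigma_poly n \<sigma> a \<in> C2})"

definition left_scale :: "'a::field \<Rightarrow> ('a \<Rightarrow> 'a) \<Rightarrow> 'a \<Rightarrow> 'a" where
  "left_scale c f = (\<lambda>x. c * f x)"

interpretation left: vector_space left_scale
  by unfold_locales (auto simp: left_scale_def fun_eq_iff algebra_simps)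

definition psi :: "'a::field \<Rightarrow> nat \<Rightarrow> ('a \<Rightarrow> 'a) \<Rightarrow> 'a \<Rightarrow> 'a" where
  "psi h t \<tau> = (\<lambda>x. \<tau> x + (\<tau> ^^ (t - 1)) x + h * \<tau> h * (\<tau> ^^ (t + 1)) x
                  + h * inv \<tau> (inverse h) * (\<tau> ^^ (2 * t - 1)) x)"

definition code :: "'a::field \<Rightarrow> nat \<Rightarrow> ('a \<Rightarrow> 'a) \<Rightarrow> ('a \<Rightarrow> 'a) set" where
  "code h t \<tau> = left.span {id, psi h t \<tau>}"

(* The norm from F_{q^(2t)} to F_{q^t}. *)
definition half_norm :: "nat \<Rightarrow> nat \<Rightarrow> 'a::field \<Rightarrow> 'a" where
  "half_norm q t h = h ^ (q ^ t + 1)"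

end

(*
  An equivalence C_h = f1 o C_k^rho o f2 puts the conjugates by f1 of all scalars into the left
  idealiser of C_h. That idealiser consists of scalars only, because psi o psi is not in
  <id, psi>; hence f1 is a scalar times a field automorphism and one may assume C_h = C_k o f with
  f = a + b psi_h bijective and psi_k o f in C_h. Linear independence of the powers of sigma
  allows one to compare coefficients. If a = 0 the degree-0 term gives a contradiction; if a \<noteq> 0
  the term a^(sigma^s) in degree s can only be cancelled when 2s = t + 1 or 2s = t - 1 modulo n.

  In this last case t is odd, and with tau = sigma^s or sigma^(-s) everything is expressed
  through tau, since sigma = tau^(t + 2). Comparing coefficients yields multiplicative relations
  between a, b, h, k; the map N x = prod_{i<t} tau^(2i)(x), for which N(-1) = -1, turns
  them into (N h)^2 = 1. So N h is 1 or -1, against N h * tau(N h) = N(h sigma^t(h)) = -1.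
*)
theory Submission
  imports Defs "HOL-Computational_Algebra.Polynomial" "HOL-Number_Theory.Residues"
begin

section \<open>Operators in the powers of a cyclic group of automorphisms\<close>

text \<open>Dedekind's independence of characters, by induction on \<open>S\<close>: evaluating the
  relation at \<open>y * x\<close> and subtracting \<open>g0 y\<close> times the relation at x
  eliminates \<open>g0\<close>.\<close>

lemma independent_characters:
  fixes c :: "('a::field \<Rightarrow> 'a) \<Rightarrow> 'a"
  assumes "finite S"
    and "\<And>g. g \<in> S \<Longrightarrow> g 1 = 1"
    and "\<And>g x y. g \<in> S \<Longrightarrow> g (x * y) = g x * g y"
    and "\<And>x. (\<Sum>g\<in>S. c g * g x) = 0"
    and "g \<in> S"
  shows "c g = 0"
  using assms
proof (induction S arbitrary: c g rule: finite_induct)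
  case empty
  then show ?case by simp
next
  case (insert g0 S)
  have zero: "c g * (g y - g0 y) = 0" if "g \<in> S" for g y
  proof (rule insert.IH[where c = "\<lambda>g. c g * (g y - g0 y)"])
    fix x :: 'a
    have "0 = (\<Sum>g\<in>insert g0 S. c g * g (y * x)) - g0 y * (\<Sum>g\<in>insert g0 S. c g * g x)"
      by (simp only: insert.prems(3)) simp
    also have "\<dots> = (\<Sum>g\<in>insert g0 S. c g * (g y - g0 y) * g x)"
      unfolding sum_distrib_left sum_subtractf[symmetric]
      by (intro sum.cong refl) (simp add: insert.prems(2) algebra_simps)
    also have "\<dots> = (\<Sum>g\<in>S. c g * (g y - g0 y) * g x)"
      using insert.hyps by simp
    finally show "(\<Sum>g\<in>S. c g * (g y - g0 y) * g x) = 0" by simp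
  next
    fix g assume "g \<in> S"
    then show "g 1 = 1" by (simp add: insert.prems(1))
  next
    fix g x y assume "g \<in> S"
    then show "g (x * y) = g x * g y" by (simp add: insert.prems(2))
  qed (fact that)
  have c0: "c g = 0" if "g \<in> S" for g
  proof -
    have "g \<noteq> g0" using that insert.hyps by auto
    then obtain y where "g y \<noteq> g0 y" by (auto simp: fun_eq_iff)
    then show ?thesis using zero[OF that, of y] by simp
  qed
  have "(\<Sum>g\<in>insert g0 S. c g * g 1) = c g0"
    using insert.hyps insert.prems(1) c0 by simp
  then have "c g0 = 0" using insert.prems(3) by metis
  then show ?case using c0 insert.prems(4) by blast
qed

text \<open>\<open>P i\<close> models the i-th power, i any integer, of a generator of a cyclic
  group of order 2 * t of field automorphisms. The group is kept abstract so that the locale can be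
  interpreted a second time for \<tau> = \<open>P r\<close> with r coprime to 2 * t.\<close>

locale cyclic_automorphisms =
  fixes P :: "int \<Rightarrow> 'a::field \<Rightarrow> 'a" and t :: int
  assumes P_comp: "P i (P j x) = P (i + j) x"
    and P_add [simp]: "P i (x + y) = P i x + P i y"
    and P_mult [simp]: "P i (x * y) = P i x * P i y"
    and P_1 [simp]: "P i 1 = 1"
    and P_0: "P 0 x = x"
    and P_eq_iff: "P i = P j \<longleftrightarrow> [i = j] (mod 2 * t)"
    and t_ge_5: "t \<ge> 5"
    and odd_char: "(1::'a) \<noteq> - 1"
begin

lemma P_zero [simp]: "P i 0 = 0"
  using P_add[of i 0 0] by (simp only: add_0_right add_cancel_right_right)

lemma P_minus [simp]: "P i (- x) = - P i x"
  using P_add[of i x "- x"] by (simp add: eq_neg_iff_add_eq_0 add.commute)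

lemma P_diff [simp]: "P i (x - y) = P i x - P i y"
  using P_add[of i x "- y"] by simp

lemma P_inverse [simp]: "P i (inverse x) = inverse (P i x)"
proof (cases "x = 0")
  case False
  then have "P i x * P i (inverse x) = 1"
    by (simp flip: P_mult)
  then show ?thesis by (metis inverse_unique)
qed simp

lemma P_divide [simp]: "P i (x / y) = P i x / P i y"
  by (simp add: divide_inverse)

lemma P_inv: "P (- i) (P i x) = x" "P i (P (- i) x) = x"
  by (simp_all add: P_comp P_0)

lemma P_inj: "P i x = P i y \<longleftrightarrow> x = y"
  using P_inv(1) by metis

lemma P_eq_0_iff [simp]: "P i x = 0 \<longleftrightarrow> x = 0"
  using P_inj[of i x 0] by simp

lemma P_power [simp]: "P i (x ^ k) = P i x ^ k"
  by (induction k) simp_all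

lemma P_cong: "[i = j] (mod 2 * t) \<Longrightarrow> P i x = P j x"
  by (simp flip: P_eq_iff)

(* Operators are encoded as lists of terms (c, i), standing for c * P i; exponents count modulo
   2 * t, and op_coeff j is the coefficient of P j. *)
definition op_eval :: "('a \<times> int) list \<Rightarrow> 'a \<Rightarrow> 'a" where
  "op_eval L x = (\<Sum>(c, i)\<leftarrow>L. c * P i x)"

definition op_coeff :: "int \<Rightarrow> ('a \<times> int) list \<Rightarrow> 'a" where
  "op_coeff j L = (\<Sum>(c, i)\<leftarrow>L. if [i = j] (mod 2 * t) then c else 0)"

text \<open>A twisted product: moving \<open>P i\<close> past a coefficient d turns it into
  \<open>P i d\<close>.\<close>

definition op_mult :: "('a \<times> int) list \<Rightarrow> ('a \<times> int) list \<Rightarrow> ('a \<times> int) list" where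
  "op_mult L M = [(c * P i d, i + j). (c, i) \<leftarrow> L, (d, j) \<leftarrow> M]"

lemma op_eval_simps [simp]:
  "op_eval [] x = 0" "op_eval ((c, i) # L) x = c * P i x + op_eval L x" "op_eval (L @ M) x = op_eval L x + op_eval M x"
  by (simp_all add: op_eval_def)

lemma op_coeff_simps [simp]:
  "op_coeff j [] = 0" "op_coeff j ((c, i) # L) = (if [i = j] (mod 2 * t) then c else 0) + op_coeff j L"
  by (simp_all add: op_coeff_def)

lemma op_mult_simps [simp]:
  "op_mult [] M = []"
  "op_mult ((c, i) # L) M = map (\<lambda>(d, j). (c * P i d, i + j)) M @ op_mult L M"
  by (simp_all add: op_mult_def)

lemma op_eval_map: "op_eval (map (\<lambda>(d, j). (c * P i d, i + j)) M) x = c * P i (op_eval M x)"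
  by (induction M) (auto simp: P_comp algebra_simps)

lemma op_eval_op_mult: "op_eval (op_mult L M) x = op_eval L (op_eval M x)"
  by (induction L) (auto simp: op_eval_map)

lemma op_coeff_append [simp]: "op_coeff j (L @ M) = op_coeff j L + op_coeff j M"
  by (simp add: op_coeff_def)

lemma op_eval_scale: "op_eval (map (\<lambda>(d, j). (c * d, j)) M) x = c * op_eval M x"
  by (induction M) (auto simp: algebra_simps)

lemma op_coeff_scale: "op_coeff j (map (\<lambda>(d, i). (c * d, i)) M) = c * op_coeff j M"
  by (induction M) (auto simp: algebra_simps)

lemma op_coeff_eq_0:
  assumes "\<And>x. op_eval L x = 0"
  shows "op_coeff j L = 0"
proof -
  \<comment> \<open>Terms are collected by the map \<open>P i\<close> rather than by i, since
    congruent exponents give the same automorphism. \<open>P j\<close> is inserted to cover degrees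
    absent from L.\<close>
  define S where "S = insert (P j) (P ` snd ` set L)"
  define C where "C g = (\<Sum>(c, i)\<leftarrow>L. if P i = g then c else 0)" for g
  have "(\<Sum>g\<in>S. C g * g x) = op_eval L x" for x
  proof -
    have "P ` snd ` set M \<subseteq> S \<Longrightarrow>
        (\<Sum>g\<in>S. (\<Sum>(c, i)\<leftarrow>M. if P i = g then c else 0) * g x) = op_eval M x" for M
    proof (induction M)
      case Nil
      then show ?case by simp
    next
      case (Cons p M)
      obtain c i where p: "p = (c, i)" by (cases p)
      have S: "finite S" "P i \<in> S" using Cons.prems by (auto simp: S_def p)
      have "(\<Sum>g\<in>S. (if P i = g then c else 0) * g x) = (\<Sum>g\<in>S. if P i = g then c * P i x else 0)"
        by (intro sum.cong) auto
      also have "\<dots> = c * P i x" using S by (simp add: sum.delta)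
      finally show ?case using Cons by (simp add: p distrib_right sum.distrib)
    qed
    from this[of L] show ?thesis by (auto simp: S_def C_def)
  qed
  then have "C (P j) = 0"
    using assms by (intro independent_characters[where S = S and c = C and g = "P j"]) (auto simp: S_def)
  then show ?thesis by (simp add: C_def op_coeff_def P_eq_iff)
qed

lemma op_coeff_cong:
  assumes "\<And>x. op_eval L x = op_eval M x"
  shows "op_coeff j L = op_coeff j M"
proof -
  have "op_eval (L @ map (\<lambda>(d, i). (- 1 * d, i)) M) x = 0" for x
    using assms by (simp only: op_eval_simps op_eval_scale) simp
  from op_coeff_eq_0[OF this, of j] show ?thesis by (simp only: op_coeff_append op_coeff_scale) simp
qed

(* Exponents \<alpha> * t + \<beta> are kept folded, so that the simplifier can decide congruences between
   them by comparing numerals (ix_cong). *)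
definition ix :: "int \<Rightarrow> int \<Rightarrow> int" where
  "ix \<alpha> \<beta> = \<alpha> * t + \<beta>"

lemma ix_add [simp]: "ix \<alpha> \<beta> + ix \<gamma> \<delta> = ix (\<alpha> + \<gamma>) (\<beta> + \<delta>)"
  by (simp add: ix_def algebra_simps)

text \<open>Modulo t only \<beta> - \<delta> is left, and the bound makes it 0; the remaining
  multiple of t is divisible by 2 * t exactly when its factor is even.\<close>

lemma ix_cong:
  assumes "\<bar>\<beta> - \<delta>\<bar> < t"
  shows "[ix \<alpha> \<beta> = ix \<gamma> \<delta>] (mod 2 * t) \<longleftrightarrow> \<beta> = \<delta> \<and> even (\<alpha> - \<gamma>)"
proof -
  have eq: "ix \<alpha> \<beta> - ix \<gamma> \<delta> = (\<alpha> - \<gamma>) * t + (\<beta> - \<delta>)"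
    by (simp add: ix_def algebra_simps)
  show ?thesis
  proof
    assume "[ix \<alpha> \<beta> = ix \<gamma> \<delta>] (mod 2 * t)"
    then have *: "2 * t dvd (\<alpha> - \<gamma>) * t + (\<beta> - \<delta>)"
      by (simp add: cong_iff_dvd_diff eq)
    then have "t dvd (\<alpha> - \<gamma>) * t + (\<beta> - \<delta>)" by (rule dvd_mult_right)
    then have "t dvd \<beta> - \<delta>" by simp
    then have "\<beta> = \<delta>" using assms dvd_imp_le_int[of "\<beta> - \<delta>" t] by force
    with * show "\<beta> = \<delta> \<and> even (\<alpha> - \<gamma>)" using t_ge_5 by simp
  next
    assume "\<beta> = \<delta> \<and> even (\<alpha> - \<gamma>)"
    then have "2 * t dvd (\<alpha> - \<gamma>) * t + (\<beta> - \<delta>)" by simp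
    then show "[ix \<alpha> \<beta> = ix \<gamma> \<delta>] (mod 2 * t)"
      by (simp only: cong_iff_dvd_diff eq)
  qed
qed


subsection \<open>The case of half exponents\<close>

lemma P_prod: "P i (\<Prod>j\<in>J. f j) = (\<Prod>j\<in>J. P i (f j))"
  by (induction J rule: infinite_finite_induct) simp_all

text \<open>The exponents 2 * i with i < t run through the subgroup of index 2, so this is the norm
  to the fixed field of \<open>P 2\<close>.\<close>

definition half_orbit_prod :: "'a \<Rightarrow> 'a" where
  "half_orbit_prod x = (\<Prod>i<nat t. P (2 * int i) x)"

lemma half_orbit_prod_mult [simp]:
  "half_orbit_prod (x * y) = half_orbit_prod x * half_orbit_prod y"
  by (simp add: half_orbit_prod_def prod.distrib)

lemma half_orbit_prod_eq_0_iff [simp]: "half_orbit_prod x = 0 \<longleftrightarrow> x = 0"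
  using t_ge_5 by (auto simp: half_orbit_prod_def intro!: exI[of _ 0])

lemma half_orbit_prod_1 [simp]: "half_orbit_prod 1 = 1"
  by (simp add: half_orbit_prod_def)

lemma half_orbit_prod_divide [simp]:
  "half_orbit_prod (x / y) = half_orbit_prod x / half_orbit_prod y"
  by (simp add: half_orbit_prod_def prod_dividef)

lemma P_half_orbit_prod: "P i (half_orbit_prod x) = half_orbit_prod (P i x)"
  by (simp add: half_orbit_prod_def P_prod P_comp add.commute)

text \<open>\<open>P 2\<close> shifts the factors cyclically: the factor with exponent 2 * t is the
  one with exponent 0.\<close>

lemma half_orbit_prod_P2: "half_orbit_prod (P 2 x) = half_orbit_prod x"
proof (cases "x = 0")
  case False
  define g where "g i = P (2 * int i) x" for i
  have "g 0 * (\<Prod>i<nat t. g (Suc i)) = (\<Prod>i<nat t. g i) * g (nat t)"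
    by (metis prod.lessThan_Suc prod.lessThan_Suc_shift)
  moreover have "g (nat t) = g 0"
    unfolding g_def using t_ge_5 by (intro P_cong) (simp add: cong_def)
  moreover have "g 0 \<noteq> 0"
    using False by (simp add: g_def)
  ultimately have "(\<Prod>i<nat t. g (Suc i)) = (\<Prod>i<nat t. g i)"
    by (simp add: mult.commute)
  then show ?thesis
    by (simp add: half_orbit_prod_def g_def P_comp algebra_simps)
qed simp

lemma half_orbit_prod_P_even:
  assumes "even j"
  shows "half_orbit_prod (P j x) = half_orbit_prod x"
proof -
  have nat: "half_orbit_prod (P (2 * int m) x) = half_orbit_prod x" for m x
  proof (induction m arbitrary: x)
    case (Suc m)
    have "P (2 * int (Suc m)) x = P 2 (P (2 * int m) x)"
      by (simp add: P_comp algebra_simps)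
    then show ?case using Suc by (simp add: half_orbit_prod_P2)
  qed (simp add: P_0)
  obtain m where m: "j = 2 * m" using assms by blast
  show ?thesis
  proof (cases "m \<ge> 0")
    case True
    then show ?thesis using nat[of "nat m" x] m by simp
  next
    case False
    then have "half_orbit_prod (P (- j) (P j x)) = half_orbit_prod (P j x)"
      using nat[of "nat (- m)" "P j x"] m by simp
    then show ?thesis by (simp add: P_inv)
  qed
qed

text \<open>The product is invariant under even powers, so only the parity of j counts.\<close>

lemma half_orbit_prod_P_odd:
  assumes "odd j"
  shows "half_orbit_prod (P j x) = P 1 (half_orbit_prod x)"
proof -
  have "P j x = P (j - 1) (P 1 x)" by (simp add: P_comp)
  then show ?thesis
    using assms by (simp add: half_orbit_prod_P_even P_half_orbit_prod)
qed

lemma half_orbit_prod_uminus: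
  assumes "odd t"
  shows "half_orbit_prod (- x) = - half_orbit_prod x"
proof -
  have "odd (nat t)" using assms t_ge_5 by (simp add: even_nat_iff)
  then show ?thesis by (simp add: half_orbit_prod_def prod_uminus)
qed

text \<open>For odd t the product has an odd number of factors, so it sends -1 to -1, and
  \<open>P t\<close> acts on its values like \<open>P 1\<close>.\<close>

lemma half_orbit_prod_norm:
  assumes "odd t" and "h * P t h = - 1"
  shows "half_orbit_prod h * P 1 (half_orbit_prod h) = - 1"
proof -
  have "half_orbit_prod (h * P t h) = - 1"
    using assms half_orbit_prod_uminus[of 1] by simp
  then show ?thesis using assms(1) by (simp add: half_orbit_prod_P_odd)
qed

text \<open>Both 1 and -1 are fixed by \<open>P 1\<close>, so either value would turn the preceding
  relation into 1 = -1.\<close>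

lemma half_orbit_prod_square_ne_1:
  assumes "odd t" and "h * P t h = - 1"
  shows "(half_orbit_prod h)\<^sup>2 \<noteq> 1"
proof
  assume "(half_orbit_prod h)\<^sup>2 = 1"
  then have "half_orbit_prod h = 1 \<or> half_orbit_prod h = - 1"
    by (simp add: power2_eq_1_iff)
  then show False
    using half_orbit_prod_norm[OF assms] odd_char by auto
qed

text \<open>The two alternatives for the coefficients of psi2 are those of \<open>\<psi>\<^sub>k\<close> written in the powers
  of \<open>\<tau> = \<sigma>\<^sup>s\<close> and of \<open>\<tau> = \<sigma>\<^sup>-\<^sup>s\<close>. For t = 5 the degrees t + 3, 3, -3, t - 3 occur also in psi1, which
  is why d' enters.\<close>
lemma exponent_half_exclusion:
  assumes t: "odd t"
    and h: "h * P t h = - 1" and k: "k * P t k = - 1"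
    and A: "A = h * P (t + 2) h" and B: "B = h / P (t - 2) h"
    and c: "c1 = 1 \<and> c2 = k * P 1 k \<and> c3 = 1 \<and> c4 = k / P (- 1) k \<or>
            c1 = k / P 1 k \<and> c2 = 1 \<and> c3 = k * P (- 1) k \<and> c4 = 1"
    and a: "a \<noteq> 0" and b: "b \<noteq> 0"
    and psi1: "psi1 = [(1, ix 1 2), (A, ix 0 2), (1, ix 0 (- 2)), (B, ix 1 (- 2))]"
    and psi2: "psi2 = [(c1, ix 0 1), (c2, ix 1 1), (c3, ix 1 (- 1)), (c4, ix 0 (- 1))]"
    and eq: "\<And>x. op_eval psi2 (a * x + b * op_eval psi1 x) = c * x + d * op_eval psi1 x"
  shows False
proof -
  let ?N = half_orbit_prod
  define L where "L = op_mult psi2 ((a, ix 0 0) # map (\<lambda>(m, i). (b * m, i)) psi1)"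
  define R where "R = (c, ix 0 0) # map (\<lambda>(m, i). (d * m, i)) psi1"
  have "op_eval L x = op_eval R x" for x
    unfolding L_def R_def op_eval_op_mult using eq[of x] by (simp add: op_eval_scale) (simp add: ix_def P_0)
  then have coeff_eq: "op_coeff j L = op_coeff j R" for j by (rule op_coeff_cong)
  define d' where "d' = (if t = 5 then d else 0)"
  \<comment> \<open>For t >= 7 the second components of the degrees differ by at most 6, so
    \<open>ix_cong\<close> decides every congruence; t = 5 is settled by comparing residues modulo
    10.\<close>
  have "t \<noteq> 6" using t by auto
  then consider "t = 5" | "t \<ge> 7" using t_ge_5 by linarith
  then have eqs_conj:
    "c1 * P (ix 0 1) a + c3 * P (ix 1 (-1)) b + c4 * P (ix 0 (-1)) b * P (ix 0 (-1)) A = 0 \<and>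
     c4 * P (ix 0 (-1)) a + c1 * P (ix 0 1) b + c2 * P (ix 1 1) b * P (ix 1 1) B = 0 \<and>
     c1 * P (ix 0 1) b + c2 * P (ix 1 1) b * P (ix 1 1) A = d' \<and>
     c1 * P (ix 0 1) b * P (ix 0 1) A + c2 * P (ix 1 1) b = d' * B \<and>
     c3 * P (ix 1 (-1)) b + c4 * P (ix 0 (-1)) b * P (ix 0 (-1)) B = d' * A"
  proof cases
    case 1
    have c5: "[ix \<alpha> \<beta> = ix \<gamma> \<delta>] (mod 2 * t) \<longleftrightarrow> (\<alpha> * 5 + \<beta>) mod 10 = (\<gamma> * 5 + \<delta>) mod 10" for \<alpha> \<beta> \<gamma> \<delta>
      by (simp only: ix_def cong_def) (simp add: 1)
    have "d' = d" by (simp add: d'_def 1)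
    then show ?thesis
      using coeff_eq[of "ix 0 1"] coeff_eq[of "ix 0 (-1)"] coeff_eq[of "ix 1 3"] coeff_eq[of "ix 0 3"] coeff_eq[of "ix 1 (-3)"]
      by (simp add: L_def R_def psi1 psi2 c5 c5[unfolded mult.commute[of 2 t]] algebra_simps)
  next
    case 2
    then have lt: "0 < t" "1 < t" "2 < t" "3 < t" "4 < t" "5 < t" "6 < t" "t \<noteq> 5" by auto
    show ?thesis
      using coeff_eq[of "ix 0 1"] coeff_eq[of "ix 0 (-1)"] coeff_eq[of "ix 1 3"] coeff_eq[of "ix 0 3"] coeff_eq[of "ix 1 (-3)"]
      by (simp add: L_def R_def psi1 psi2 ix_cong ix_cong[unfolded mult.commute[of 2 t]] lt d'_def algebra_simps)
  qed
  then have eqs: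
    "c1 * P (ix 0 1) a + c3 * P (ix 1 (-1)) b + c4 * P (ix 0 (-1)) b * P (ix 0 (-1)) A = 0"
    "c4 * P (ix 0 (-1)) a + c1 * P (ix 0 1) b + c2 * P (ix 1 1) b * P (ix 1 1) B = 0"
    "c1 * P (ix 0 1) b + c2 * P (ix 1 1) b * P (ix 1 1) A = d'"
    "c1 * P (ix 0 1) b * P (ix 0 1) A + c2 * P (ix 1 1) b = d' * B"
    "c3 * P (ix 1 (-1)) b + c4 * P (ix 0 (-1)) b * P (ix 0 (-1)) B = d' * A"
    by simp_all
  have P2: "P 2 h * P (t + 2) h = - 1"
    using arg_cong[OF h, of "P 2"] by (simp add: P_comp add.commute)
  have P2': "P (- 2) h * P (t - 2) h = - 1"
    using arg_cong[OF h, of "P (- 2)"] by (simp add: P_comp add.commute)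
  have nz: "h \<noteq> 0" "k \<noteq> 0" using h k by auto
  \<comment> \<open>Since h * P t h = -1, \<open>P t\<close> inverts both A and B; \<open>A1\<close>
    and \<open>B1\<close> are the shifted forms that fit the equations.\<close>
  have "P t (P (t + 2) h) = P 2 h" "P t (P (t - 2) h) = P (- 2) h"
    by (simp_all add: P_comp) (rule P_cong; simp add: cong_iff_dvd_diff)+
  then have "A * P t A = (h * P t h) * (P 2 h * P (t + 2) h)"
    "B * P t B = (h * P t h) / (P (- 2) h * P (t - 2) h)"
    by (simp_all add: A B)
  then have AB: "A * P t A = 1" "B * P t B = 1"
    by (simp_all only: h P2 P2') simp_all
  have A1: "P (ix 0 1) A * P (ix 1 1) A = 1"
    using arg_cong[OF AB(1), of "P 1"] by (simp add: P_comp ix_def add.commute)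
  have B1: "P (ix 0 1) B * P (ix 1 1) B = 1"
    using arg_cong[OF AB(2), of "P 1"] by (simp add: P_comp ix_def add.commute)
  have NA: "?N A = - 1"
    using half_orbit_prod_norm[OF t h] t by (simp add: A half_orbit_prod_P_odd)
  have Ph: "P 1 (?N h) = - 1 / ?N h" and Pk: "P 1 (?N k) = - 1 / ?N k"
    using half_orbit_prod_norm[OF t h] half_orbit_prod_norm[OF t k] nz
    by (simp_all add: field_simps)
  have NB: "?N B = - (?N h)\<^sup>2"
    using t nz by (simp add: B half_orbit_prod_P_odd Ph power2_eq_square)
  \<comment> \<open>By \<open>A1\<close>, the third equation multiplied by \<open>P 1 A\<close> has
    the left side of the fourth. If d' were nonzero, then B = \<open>P 1 A\<close>, and applying
    \<open>?N\<close> would give (N h)^2 = 1.\<close>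
  have d': "d' = 0"
  proof (rule ccontr)
    assume "d' \<noteq> 0"
    have "d' * P (ix 0 1) A =
        c1 * P (ix 0 1) b * P (ix 0 1) A + c2 * P (ix 1 1) b * (P (ix 0 1) A * P (ix 1 1) A)"
      unfolding eqs(3)[symmetric] by (simp add: algebra_simps)
    then have "d' * B = d' * P (ix 0 1) A"
      using eqs(4) A1 by auto
    then have "B = P (ix 0 1) A" using \<open>d' \<noteq> 0\<close> by simp
    then have "?N B = - 1" by (simp add: ix_def half_orbit_prod_P_odd NA)
    then show False using half_orbit_prod_square_ne_1[OF t h] NB by simp
  qed
  have E1: "c1 * P (ix 0 1) b * P (ix 0 1) A = - c2 * P (ix 1 1) b"
    using eqs(4) d' by (simp add: eq_neg_iff_add_eq_0)
  have E2: "c3 * P (ix 1 (- 1)) b = - c4 * P (ix 0 (- 1)) b * P (ix 0 (- 1)) B"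
    using eqs(5) d' by (simp add: eq_neg_iff_add_eq_0)
  \<comment> \<open>\<open>E2\<close> eliminates c3 from the degree 1 equation. For
    \<open>F2\<close> the degree -1 equation is multiplied by \<open>P 1 B\<close>, so that
    \<open>B1\<close> and \<open>E1\<close> eliminate c2. Both results contain b only through b * (B
    - A).\<close>
  have F1: "c1 * P (ix 0 1) a = c4 * P (ix 0 (- 1)) (b * (B - A))"
    using eqs(1) E2 by (simp add: algebra_simps)
  have F2: "P (ix 0 1) B * (c4 * P (ix 0 (- 1)) a) = - (c1 * P (ix 0 1) (b * (B - A)))"
  proof -
    have "0 = P (ix 0 1) B * (c4 * P (ix 0 (- 1)) a + c1 * P (ix 0 1) b + c2 * P (ix 1 1) b * P (ix 1 1) B)"
      using eqs(2) by simp
    also have "\<dots> = P (ix 0 1) B * (c4 * P (ix 0 (- 1)) a) + c1 * P (ix 0 1) b * P (ix 0 1) B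
        - (- c2 * P (ix 1 1) b) * (P (ix 0 1) B * P (ix 1 1) B)"
      by (simp add: algebra_simps)
    finally show ?thesis
      unfolding B1 E1[symmetric] by (simp add: algebra_simps eq_neg_iff_add_eq_0)
  qed
  \<comment> \<open>Shifted by -1 and by 1, \<open>E1\<close> and \<open>E2\<close> both relate b to
    \<open>P t b\<close>; in their product b * P t b cancels, which leaves a relation free of a and
    b.\<close>
  have "P (- 1) c1 * b * A = - P (- 1) c2 * P t b"
    using arg_cong[OF E1, of "P (- 1)"] by (simp add: P_comp ix_def P_0)
  moreover have "P 1 c3 * P t b = - P 1 c4 * b * B"
    using arg_cong[OF E2, of "P 1"] by (simp add: P_comp ix_def P_0)
  ultimately have "(P (- 1) c1 * P 1 c3 * A) * (b * P t b) = (P (- 1) c2 * P 1 c4 * B) * (b * P t b)"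
  proof -
    assume 1: "P (- 1) c1 * b * A = - P (- 1) c2 * P t b" and 2: "P 1 c3 * P t b = - P 1 c4 * b * B"
    have "(P (- 1) c1 * P 1 c3 * A) * (b * P t b) = (P (- 1) c1 * b * A) * (P 1 c3 * P t b)"
      by (simp add: ac_simps)
    also have "\<dots> = (P (- 1) c2 * P 1 c4 * B) * (b * P t b)"
      unfolding 1 2 by (simp add: ac_simps)
    finally show ?thesis .
  qed
  then have "P (- 1) c1 * P 1 c3 * A = P (- 1) c2 * P 1 c4 * B"
    using b by simp
  from arg_cong[OF this, of ?N]
  have X: "P 1 (?N c1) * P 1 (?N c3) = P 1 (?N c2) * P 1 (?N c4) * (?N h)\<^sup>2"
    by (simp add: half_orbit_prod_P_odd NA NB)
  \<comment> \<open>After \<open>?N\<close> the maps \<open>P 1\<close> and \<open>P (- 1)\<close>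
    act alike, so \<open>F1\<close> and \<open>F2\<close> become linear in the same K and s.
    Eliminating K and cancelling s gives \<open>Y\<close>, again free of a and b.\<close>
  define K where "K = P 1 (?N b) * P 1 (?N (B - A))"
  define s where "s = P 1 (?N a)"
  have G1: "?N c1 * s = ?N c4 * K"
    using arg_cong[OF F1, of ?N] by (simp add: half_orbit_prod_P_odd ix_def K_def s_def del: P_diff)
  have G2: "P 1 (?N B) * ?N c4 * s = - ?N c1 * K"
    using arg_cong[OF F2, of ?N] t
    by (simp add: half_orbit_prod_P_odd half_orbit_prod_uminus ix_def K_def s_def mult.assoc del: P_diff)
  have "s \<noteq> 0" using a by (simp add: s_def)
  have "P 1 (?N B) * (?N c4)\<^sup>2 * s = - (?N c1)\<^sup>2 * s"
  proof -
    have "P 1 (?N B) * (?N c4)\<^sup>2 * s = ?N c4 * (P 1 (?N B) * ?N c4 * s)"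
      by (simp add: power2_eq_square ac_simps)
    also have "\<dots> = - ?N c1 * (?N c4 * K)"
      unfolding G2 by (simp add: ac_simps)
    finally show ?thesis
      unfolding G1[symmetric] by (simp add: power2_eq_square ac_simps)
  qed
  then have "P 1 (?N B) * (?N c4)\<^sup>2 = - (?N c1)\<^sup>2"
    using \<open>s \<noteq> 0\<close> by (metis mult_right_cancel)
  then have Y: "(?N c4)\<^sup>2 = (?N h)\<^sup>2 * (?N c1)\<^sup>2"
    using nz by (simp add: NB Ph field_simps)
  \<comment> \<open>In either alternative \<open>X\<close> and \<open>Y\<close> together force (N
    k)^2 = 1, and then (N h)^2 = 1.\<close>
  have "(?N h)\<^sup>2 = 1"
    using c
  proof
    assume c: "c1 = 1 \<and> c2 = k * P 1 k \<and> c3 = 1 \<and> c4 = k / P (- 1) k"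
    have "(?N h)\<^sup>2 = (?N k)\<^sup>2"
      using X c nz by (simp add: half_orbit_prod_P_odd Pk power2_eq_square field_simps)
    moreover have "(?N k)\<^sup>2 * (?N k)\<^sup>2 = (?N h)\<^sup>2"
      using Y c nz by (simp add: half_orbit_prod_P_odd Pk power2_eq_square field_simps)
    ultimately show ?thesis
      using nz by (metis half_orbit_prod_eq_0_iff mult_cancel_left1 power_not_zero)
  next
    assume c: "c1 = k / P 1 k \<and> c2 = 1 \<and> c3 = k * P (- 1) k \<and> c4 = 1"
    have "1 / (?N k)\<^sup>2 = (?N h)\<^sup>2"
      using X c nz by (simp add: half_orbit_prod_P_odd Pk power2_eq_square field_simps)
    moreover have "1 = (?N h)\<^sup>2 * ((?N k)\<^sup>2 * (?N k)\<^sup>2)"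
      using Y c nz by (simp add: half_orbit_prod_P_odd Pk power2_eq_square field_simps)
    moreover have "1 / (?N k)\<^sup>2 * ((?N k)\<^sup>2 * (?N k)\<^sup>2) = (?N k)\<^sup>2"
      using nz by (simp only: mult.assoc[symmetric]) simp
    ultimately have "(?N k)\<^sup>2 = 1" by metis
    with \<open>1 / (?N k)\<^sup>2 = (?N h)\<^sup>2\<close> show ?thesis by simp
  qed
  then show False using half_orbit_prod_square_ne_1[OF t h] by simp
qed


subsection \<open>Comparison of two codes\<close>

text \<open>This is \<psi> for the generator \<sigma>^r, r odd: r * t is then congruent to t modulo
  2 * t, whence the degrees t - r, t + r and - r.\<close>

definition quad :: "int \<Rightarrow> 'a \<Rightarrow> 'a \<Rightarrow> 'a" where
  "quad r h x = P r x + P (t - r) x + h * P r h * P (t + r) x + h / P (- r) h * P (- r) x"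

lemma two_neq_0: "(2::'a) \<noteq> 0"
  using odd_char by (metis add_eq_0_iff one_add_one)

text \<open>If v were nonzero, the coefficients of \<psi> o \<psi> in degrees 2 and t would vanish.
  Degree 2 gives P 2 h = - h, degree t gives h^2 = -1. The latter implies P 1 h = h or P 1 h = - h,
  so P 2 h = h, impossible in odd characteristic.\<close>

lemma quad_square_notin_span:
  assumes h: "h * P t h = - 1"
    and eq: "\<And>x. u * quad 1 h x + v * quad 1 h (quad 1 h x) = c * x + d * quad 1 h x"
  shows "v = 0"
proof (rule ccontr)
  assume "v \<noteq> 0"
  define A B where "A = h * P 1 h" and "B = h / P (- 1) h"
  define L where "L = [(1, ix 0 1), (1, ix 1 (- 1)), (A, ix 1 1), (B, ix 0 (- 1))]"
  have quad: "op_eval L x = quad 1 h x" for x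
    by (simp add: L_def quad_def A_def B_def ix_def)
  have "op_eval (map (\<lambda>(m, i). (u * m, i)) L @ map (\<lambda>(m, i). (v * m, i)) (op_mult L L)) x =
      op_eval ((c, ix 0 0) # map (\<lambda>(m, i). (d * m, i)) L) x" for x
    using eq[of x] by (simp add: op_eval_scale op_eval_op_mult quad) (simp add: ix_def P_0)
  note coeff_eq = op_coeff_cong[OF this]
  have lt: "0 < t" "1 < t" "2 < t" "3 < t" "4 < t" using t_ge_5 by auto
  have "v * (1 + A * P (ix 1 1) A) = 0"
    using coeff_eq[of "ix 0 2"] by (simp add: L_def ix_cong lt distrib_left del: mult_eq_0_iff)
  then have 1: "1 + A * P (ix 1 1) A = 0" using \<open>v \<noteq> 0\<close> by simp
  have "v + v + v * (A * P (ix 1 1) B) + v * (B * P (ix 0 (- 1)) A) = 0"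
    using coeff_eq[of "ix 1 0"] by (simp add: L_def ix_cong lt add.assoc)
  then have "v * (2 + A * P (ix 1 1) B + B * P (ix 0 (- 1)) A) = 0"
    by (simp add: distrib_left mult_2_right del: mult_eq_0_iff)
  then have 2: "2 + A * P (ix 1 1) B + B * P (ix 0 (- 1)) A = 0" using \<open>v \<noteq> 0\<close> by simp
  have h1: "P 1 h * P (t + 1) h = - 1" and h2: "P 2 h * P (t + 2) h = - 1"
    using arg_cong[OF h, of "P 1"] arg_cong[OF h, of "P 2"] by (simp_all add: P_comp add.commute)
  have inv: "y = - 1 / x" if "x * y = - 1" for x y :: 'a
    using that by (metis mult_zero_left neg_equal_0_iff_equal nonzero_mult_div_cancel_left zero_neq_one)
  have nz: "h \<noteq> 0" "P t h = - 1 / h" "P (t + 2) h = - 1 / P 2 h"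
    using h inv[OF h] inv[OF h2] by auto
  have "A * P (ix 1 1) A = h * (P 1 h * P (t + 1) h) * P (t + 2) h"
    by (simp add: A_def P_comp ix_def algebra_simps)
  then have "P 2 h = - h"
    using 1 nz by (simp only: h1) (simp add: field_simps eq_neg_iff_add_eq_0)
  have "A * P (ix 1 1) B = h * (P 1 h * P (t + 1) h) / P t h" "B * P (ix 0 (- 1)) A = h * h"
    using nz by (simp_all add: A_def B_def P_comp P_0 ix_def algebra_simps)
  then have "2 * (h * h + 1) = 0"
    using 2 nz by (simp only: h1) (simp add: field_simps)
  then have "h * h + 1 = 0"
    using two_neq_0 by (metis mult_eq_0_iff)
  then have hh: "h * h = - 1"
    by (simp add: eq_neg_iff_add_eq_0)
  have "P 1 h * P 1 h = h * h"
    using arg_cong[OF hh, of "P 1"] by (simp only: P_mult) (simp add: hh)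
  then have "P 1 h = h \<or> P 1 h = - h" by (simp add: square_eq_iff)
  then have "P 1 (P 1 h) = h" by auto
  then have "h = - h" using \<open>P 2 h = - h\<close> by (simp add: P_comp)
  then have "2 * h = 0" by (metis add.right_inverse mult_2)
  then show False using two_neq_0 nz by simp
qed

lemma cyclic_automorphisms_reindex:
  assumes "coprime r (2 * t)"
  shows "cyclic_automorphisms (\<lambda>i. P (r * i)) t"
proof
  show "(P (r * i) = P (r * j)) = [i = j] (mod 2 * t)" for i j
    using assms by (simp add: P_eq_iff cong_mult_lcancel)
qed (simp_all add: P_comp P_0 distrib_left t_ge_5 odd_char)

text \<open>Passes to \<tau> = \<sigma>^r. As r is odd, r * t is congruent to t, hence r * (t + 2)
  to 1, so \<sigma> = \<tau>^(t + 2). The case s = - r yields the second alternative for c1 to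
  c4.\<close>

lemma quad_reindexed_exclusion:
  assumes t: "odd t" and r: "coprime r (2 * t)" and half: "[2 * r = t + 1] (mod 2 * t)"
    and h: "h * P t h = - 1" and k: "k * P t k = - 1"
    and s: "s = r \<or> s = - r"
    and a: "a \<noteq> 0" and b: "b \<noteq> 0"
    and eq: "\<And>x. quad s k (a * x + b * quad 1 h x) = c * x + d * quad 1 h x"
  shows False
proof -
  interpret Q: cyclic_automorphisms "\<lambda>i. P (r * i)" t
    by (rule cyclic_automorphisms_reindex) (rule r)
  have "odd r" using r by (auto simp: coprime_mult_right_iff)
  then obtain l where l: "r = 2 * l + 1" by (rule oddE)
  obtain m where "2 * r - (t + 1) = 2 * t * m"
    using half unfolding cong_iff_dvd_diff dvd_def by blast
  then have m: "2 * r = 2 * t * m + t + 1" by simp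
  have P_eqI: "P i x = P j x" if "i - j = 2 * t * d" for i j d x
    using that by (intro P_cong) (simp add: cong_iff_dvd_diff)
  have Q: "P (r * (t + 2)) x = P 1 x" "P (r * 2) x = P (t + 1) x" "P (r * (- 2)) x = P (t - 1) x"
    "P (r * (t - 2)) x = P (- 1) x" "P (r * t) x = P t x" "P (r * (t + 1)) x = P (t + r) x"
    "P (r * (t - 1)) x = P (t - r) x" for x
  proof -
    have rt: "r * t = 2 * t * l + t" by (simp add: l algebra_simps)
    show "P (r * (t + 2)) x = P 1 x"
      by (rule P_eqI[of _ _ "l + m + 1"]) (use rt m in \<open>simp add: algebra_simps\<close>)
    show "P (r * 2) x = P (t + 1) x"
      by (rule P_eqI[of _ _ m]) (use m in \<open>simp add: algebra_simps\<close>)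
    show "P (r * (- 2)) x = P (t - 1) x"
      by (rule P_eqI[of _ _ "- m - 1"]) (use m in \<open>simp add: algebra_simps\<close>)
    show "P (r * (t - 2)) x = P (- 1) x"
      by (rule P_eqI[of _ _ "l - m"]) (use rt m in \<open>simp add: algebra_simps\<close>)
    show "P (r * t) x = P t x" "P (r * (t + 1)) x = P (t + r) x" "P (r * (t - 1)) x = P (t - r) x"
      by (rule P_eqI[of _ _ l]; use rt in \<open>simp add: algebra_simps\<close>)+
  qed
  define A B where "A = h * P 1 h" and "B = h / P (- 1) h"
  define psi1 where "psi1 = [(1::'a, Q.ix 1 2), (A, Q.ix 0 2), (1, Q.ix 0 (- 2)), (B, Q.ix 1 (- 2))]"
  have psi1: "Q.op_eval psi1 x = quad 1 h x" for x
    by (simp add: psi1_def quad_def A_def B_def Q.ix_def Q[simplified])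
  obtain c1 c2 c3 c4 where c: "c1 = 1 \<and> c2 = k * P (r * 1) k \<and> c3 = 1 \<and> c4 = k / P (r * (- 1)) k \<or>
            c1 = k / P (r * 1) k \<and> c2 = 1 \<and> c3 = k * P (r * (- 1)) k \<and> c4 = 1"
    and psi2: "\<And>x. quad s k x = c1 * P r x + c2 * P (t + r) x + c3 * P (t - r) x + c4 * P (- r) x"
  proof (cases "s = r")
    case True
    show ?thesis
      by (rule that[of 1 "k * P r k" 1 "k / P (- r) k"]) (simp_all add: True quad_def)
  next
    case False
    with s have "s = - r" by simp
    then show ?thesis
      by (intro that[of "k / P r k" 1 "k * P (- r) k" 1]) (simp_all add: quad_def)
  qed
  define psi2 where "psi2 = [(c1, Q.ix 0 1), (c2, Q.ix 1 1), (c3, Q.ix 1 (- 1)), (c4, Q.ix 0 (- 1))]"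
  have psi2': "Q.op_eval psi2 x = quad s k x" for x
    by (simp add: psi2_def psi2 Q.ix_def Q[simplified])
  show False
  proof (rule Q.exponent_half_exclusion[where ?psi1.0 = psi1 and ?psi2.0 = psi2])
    show "h * P (r * t) h = - 1" "k * P (r * t) k = - 1" using h k by (simp_all add: Q)
    show "A = h * P (r * (t + 2)) h" "B = h / P (r * (t - 2)) h"
      unfolding Q by (simp_all add: A_def B_def)
    show "Q.op_eval psi2 (a * x + b * Q.op_eval psi1 x) = c * x + d * Q.op_eval psi1 x" for x
      unfolding psi1 psi2' by (rule eq)
  qed (fact t c a b psi1_def psi2_def)+
qed

lemma quad_exclusion:
  assumes r: "coprime r (2 * t)"
    and r_ne: "\<not> [r = 1] (mod 2 * t)" "\<not> [r = - 1] (mod 2 * t)"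
      "\<not> [r = t - 1] (mod 2 * t)" "\<not> [r = t + 1] (mod 2 * t)"
    and h: "h * P t h = - 1" and k: "k * P t k = - 1"
    and eq: "\<And>x. quad r k (a * x + b * quad 1 h x) = c * x + d * quad 1 h x"
    and surj: "surj (\<lambda>x. a * x + b * quad 1 h x)"
  shows False
proof -
  \<comment> \<open>Exponents have the form \<alpha> * t + \<beta> + \<gamma> * r. For general r
    they are told apart modulo t, where \<alpha> drops out; \<open>bad\<close> marks the differences
    in \<beta> and \<gamma> that exclude a congruence.\<close>
  define bad where "bad m g \<longleftrightarrow> \<not> t dvd m + g * r" for m g
  define jx where "jx \<alpha> \<beta> \<gamma> = \<alpha> * t + \<beta> + \<gamma> * r" for \<alpha> \<beta> \<gamma>
  have jx_add: "jx \<alpha> \<beta> \<gamma> + jx \<alpha>' \<beta>' \<gamma>' = jx (\<alpha> + \<alpha>') (\<beta> + \<beta>') (\<gamma> + \<gamma>')" for \<alpha> \<beta> \<gamma> \<alpha>' \<beta>' \<gamma>'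
    by (simp add: jx_def algebra_simps)
  have jx_cong: "\<not> [jx \<alpha> \<beta> \<gamma> = jx \<alpha>' \<beta>' \<gamma>'] (mod 2 * t)"
    if "bad (\<beta> - \<beta>') (\<gamma> - \<gamma>')" for \<alpha> \<beta> \<gamma> \<alpha>' \<beta>' \<gamma>'
  proof
    assume "[jx \<alpha> \<beta> \<gamma> = jx \<alpha>' \<beta>' \<gamma>'] (mod 2 * t)"
    then have "t dvd jx \<alpha> \<beta> \<gamma> - jx \<alpha>' \<beta>' \<gamma>'"
      by (meson cong_iff_dvd_diff dvd_mult_right)
    also have "jx \<alpha> \<beta> \<gamma> - jx \<alpha>' \<beta>' \<gamma>' = (\<alpha> - \<alpha>') * t + ((\<beta> - \<beta>') + (\<gamma> - \<gamma>') * r)"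
      by (simp add: jx_def algebra_simps)
    finally show False using that by (simp add: bad_def)
  qed
  have small: "bad 1 0" "bad (- 1) 0"
    using t_ge_5 by (auto simp: bad_def dest: zdvd_imp_le)
  have "coprime r t" "odd r" using r by (auto simp: coprime_mult_right_iff)
  have "\<not> t dvd 2 * r"
  proof
    assume "t dvd 2 * r"
    then have "t dvd 2" using \<open>coprime r t\<close> by (simp add: coprime_commute coprime_dvd_mult_left_iff)
    then show False using t_ge_5 by (auto dest: zdvd_imp_le)
  qed
  then have badr: "bad 0 2" "bad 0 (- 2)" "bad 0 1" "bad 0 (- 1)"
    by (auto simp: bad_def)
  \<comment> \<open>A residue modulo t has two lifts modulo 2 * t; the four excluded values of r are
    thus exactly the lifts of 1 and -1.\<close>
  have t_dvd: "[x = e] (mod 2 * t) \<or> [x = t + e] (mod 2 * t)" if "t dvd x - e" for x e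
  proof -
    obtain m where m: "x - e = t * m" using \<open>t dvd x - e\<close> by blast
    show ?thesis
    proof (cases "even m")
      case True
      then show ?thesis by (auto simp: cong_iff_dvd_diff m)
    next
      case False
      then obtain l where "m = 2 * l + 1" by (rule oddE)
      then have "x - (t + e) = 2 * t * l" using m by (simp add: algebra_simps)
      then show ?thesis by (simp add: cong_iff_dvd_diff)
    qed
  qed
  have "\<not> t dvd r - 1" "\<not> t dvd r + 1"
    using t_dvd[of r 1] t_dvd[of r "- 1"] r_ne by auto
  then have "\<not> t dvd - 1 + r" "\<not> t dvd 1 + r" "\<not> t dvd - (- 1 + r)" "\<not> t dvd - (1 + r)"
    by (simp_all only: dvd_minus_iff) (simp_all add: add.commute)
  then have bad1: "bad 1 1" "bad (- 1) 1" "bad 1 (- 1)" "bad (- 1) (- 1)"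
    by (simp_all add: bad_def algebra_simps)
  \<comment> \<open>These exponents agree modulo t, so \<open>bad\<close> cannot separate them; they
    differ by t modulo 2 * t.\<close>
  have bad_t: "\<not> [jx 1 0 1 = jx 0 0 1] (mod 2 * t)"
    using t_ge_5 by (auto simp: jx_def cong_iff_dvd_diff dest: zdvd_imp_le)
  define A B where "A = h * P 1 h" and "B = h / P (- 1) h"
  define psi1 where "psi1 = [(1, jx 0 1 0), (1, jx 1 (- 1) 0), (A, jx 1 1 0), (B, jx 0 (- 1) 0)]"
  have psi1: "op_eval psi1 x = quad 1 h x" for x
    by (simp add: psi1_def quad_def A_def B_def jx_def)
  define C D where "C = k * P r k" and "D = k / P (- r) k"
  define psi2 where "psi2 = [(1, jx 0 0 1), (1, jx 1 0 (- 1)), (C, jx 1 0 1), (D, jx 0 0 (- 1))]"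
  have psi2: "op_eval psi2 x = quad r k x" for x
    by (simp add: psi2_def quad_def C_def D_def jx_def)
  define L where "L = op_mult psi2 ((a, jx 0 0 0) # map (\<lambda>(m, i). (b * m, i)) psi1)"
  define R where "R = (c, jx 0 0 0) # map (\<lambda>(m, i). (d * m, i)) psi1"
  have "op_eval L x = op_eval R x" for x
    unfolding L_def R_def op_eval_op_mult psi2 using eq[of x] by (simp add: op_eval_scale psi1) (simp add: jx_def P_0)
  then have coeff_eq: "op_coeff j L = op_coeff j R" for j by (rule op_coeff_cong)
  note decide = jx_add jx_cong small badr bad1 bad_t
  have "a \<noteq> 0"
  proof
    assume "a = 0"
    then have "c = 0"
      using coeff_eq[of "jx 0 0 0"] by (simp add: L_def R_def psi1_def psi2_def decide)
    have "b \<noteq> 0"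
    proof
      assume "b = 0"
      with surj \<open>a = 0\<close> have "surj (\<lambda>x::'a. 0::'a)" by simp
      then have "(1::'a) = 0" by (metis surjD)
      then show False by simp
    qed
    \<comment> \<open>With a = c = 0, \<psi>_k acts as the scalar d / b on the image of b *
      \<psi>_h, which is everything by surjectivity; yet its coefficient in degree r is 1.\<close>
    have "op_eval psi2 y = op_eval [(d / b, jx 0 0 0)] y" for y
    proof -
      obtain x where "y = b * quad 1 h x"
        using surj \<open>a = 0\<close> by (auto dest: surjD)
      then show ?thesis
        unfolding psi2 using eq[of x] \<open>a = 0\<close> \<open>c = 0\<close> \<open>b \<noteq> 0\<close> by (simp add: jx_def P_0)
    qed
    from op_coeff_cong[OF this, of "jx 0 0 1"] show False
      by (simp add: psi2_def decide)
  qed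
  have "b \<noteq> 0"
  proof
    assume "b = 0"
    then have "P (jx 0 0 1) a = 0"
      using coeff_eq[of "jx 0 0 1"] by (simp add: L_def R_def psi1_def psi2_def decide)
    then show False using \<open>a \<noteq> 0\<close> by simp
  qed
  have "[2 * r = t + 1] (mod 2 * t) \<or> [2 * r = t - 1] (mod 2 * t)"
  proof (rule ccontr)
    assume *: "\<not> ?thesis"
    \<comment> \<open>Besides the term with a, degree r could only come from degrees \<alpha> * t +
      \<beta> - r with \<beta> = 1 or -1. Parity forces \<alpha> to be odd, so \<alpha> may be
      replaced by 1, contrary to the assumption.\<close>
    have odd_dvd: "\<not> 2 * t dvd 2 * r - (\<alpha> * t + \<beta>)" if "\<beta> = 1 \<or> \<beta> = - 1" for \<alpha> \<beta>
    proof
      assume dvd: "2 * t dvd 2 * r - (\<alpha> * t + \<beta>)"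
      have "even (2 * r - (\<alpha> * t + \<beta>))" using dvd by (rule dvd_mult_left)
      with that have "odd (\<alpha> * t)" by auto
      then obtain l where "\<alpha> = 2 * l + 1" by (auto elim: oddE)
      then have "2 * r - (\<alpha> * t + \<beta>) = (2 * r - (t + \<beta>)) - 2 * t * l"
        by (simp add: algebra_simps)
      then have "2 * t dvd 2 * r - (t + \<beta>)" using dvd by (metis dvd_diffD dvd_triv_left dvd_diff_right_iff dvd_diff_left_iff dvd_minus_iff minus_diff_eq)
      then show False using * that by (auto simp: cong_iff_dvd_diff)
    qed
    have "\<not> [jx \<alpha> \<beta> (- 1) = jx 0 0 1] (mod 2 * t)" if "\<beta> = 1 \<or> \<beta> = - 1" for \<alpha> \<beta>
    proof -
      have "jx \<alpha> \<beta> (- 1) - jx 0 0 1 = - (2 * r - (\<alpha> * t + \<beta>))" by (simp add: jx_def)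
      then show ?thesis using odd_dvd[OF that] by (simp only: cong_iff_dvd_diff dvd_minus_iff) simp
    qed
    then have "P (jx 0 0 1) a = 0"
      using coeff_eq[of "jx 0 0 1"] by (simp add: L_def R_def psi1_def psi2_def decide)
    then show False using \<open>a \<noteq> 0\<close> by simp
  qed
  moreover have "odd t" if "[2 * r = t + e] (mod 2 * t)" "odd e" for e
  proof -
    have "even (2 * r - (t + e))" using that(1) by (meson cong_iff_dvd_diff dvd_mult_left)
    then show ?thesis using that(2) by auto
  qed
  ultimately show False
  proof (elim disjE)
    assume 1: "[2 * r = t + 1] (mod 2 * t)"
    then show False
      using quad_reindexed_exclusion[OF _ r 1 h k _ \<open>a \<noteq> 0\<close> \<open>b \<noteq> 0\<close>, of r c d] eq
        \<open>\<And>e. [2 * r = t + e] (mod 2 * t) \<Longrightarrow> odd e \<Longrightarrow> odd t\<close>[of 1] by simp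
  next
    assume 1: "[2 * r = t - 1] (mod 2 * t)"
    \<comment> \<open>Replacing r by - r reduces this case to the other one.\<close>
    have "2 * (- r) - (t + 1) = - (2 * r - (t - 1)) - 2 * t" by simp
    then have 2: "[2 * (- r) = t + 1] (mod 2 * t)"
      using 1 by (metis cong_iff_dvd_diff dvd_diff dvd_minus_iff dvd_refl)
    have "coprime (- r) (2 * t)" using r by simp
    from quad_reindexed_exclusion[OF _ this 2 h k _ \<open>a \<noteq> 0\<close> \<open>b \<noteq> 0\<close>, of r c d] show False
      using eq 1 \<open>\<And>e. [2 * r = t + e] (mod 2 * t) \<Longrightarrow> odd e \<Longrightarrow> odd t\<close>[of "- 1"] by simp
  qed
qed

end


section \<open>Automorphisms of finite fields\<close>

text \<open>The field type is repackaged as a ring record so that the cyclicity of the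
  multiplicative group of a finite field applies.\<close>

lemma finite_field_primitive_element:
  "\<exists>g::'a::{field, finite}. g \<noteq> 0 \<and> (\<forall>x. x \<noteq> 0 \<longrightarrow> (\<exists>i::nat. x = g ^ i))"
proof -
  let ?R = "\<lparr>carrier = UNIV, monoid.mult = (*), one = 1, ring.zero = 0, add = (+)\<rparr> :: 'a ring"
  have inv: "\<exists>y. x + y = 0" "x \<noteq> 0 \<Longrightarrow> \<exists>y. x * y = 1" for x :: 'a
    by (rule exI[of _ "- x"], simp) (rule exI[of _ "inverse x"], simp)
  interpret R: field ?R
    using inv by unfold_locales (auto simp: algebra_simps Units_def)
  have pow: "x [^]\<^bsub>?R\<^esub> i = x ^ i" for x and i :: nat
    by (induction i) (simp_all add: nat_pow_def mult.commute)
  obtain g where "g \<in> carrier (mult_of ?R)"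
    "carrier (mult_of ?R) = {g [^]\<^bsub>?R\<^esub> i |i::nat. i \<in> UNIV}"
    using R.finite_field_mult_group_has_gen by auto
  then have "g \<noteq> 0" "UNIV - {0} = {g ^ i |i::nat. True}"
    by (simp_all add: pow)
  then show ?thesis by blast
qed

section \<open>Field automorphisms and their action on polynomials\<close>

lemma field_autD:
  assumes "field_aut \<rho>"
  shows "bij \<rho>" "\<rho> 1 = 1" "\<rho> (x + y) = \<rho> x + \<rho> y" "\<rho> (x * y) = \<rho> x * \<rho> y"
    "\<rho> 0 = 0" "\<rho> (- x) = - \<rho> x" "\<rho> (x ^ i) = \<rho> x ^ i" "\<rho> x = 0 \<longleftrightarrow> x = 0"
proof -
  show bij: "bij \<rho>" and one: "\<rho> 1 = 1" and add: "\<rho> (x + y) = \<rho> x + \<rho> y"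
    and mult: "\<rho> (x * y) = \<rho> x * \<rho> y" for x y
    using assms by (auto simp: field_aut_def)
  show zero: "\<rho> 0 = 0"
    using add[of 0 0] by (simp only: add_0_right add_cancel_right_right)
  show "\<rho> (- x) = - \<rho> x"
    using add[of x "- x"] zero by (simp add: eq_neg_iff_add_eq_0 add.commute)
  show "\<rho> (x ^ i) = \<rho> x ^ i"
    by (induction i) (simp_all add: one mult)
  show "\<rho> x = 0 \<longleftrightarrow> x = 0"
    using zero bij by (metis bij_is_inj injD)
qed

lemma field_aut_inverse:
  assumes "field_aut \<rho>"
  shows "\<rho> (inverse x) = inverse (\<rho> x)"
proof (cases "x = 0")
  case False
  then have "\<rho> x * \<rho> (inverse x) = 1"
    by (simp flip: field_autD(4)[OF assms] add: field_autD(2)[OF assms])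
  then show ?thesis by (metis inverse_unique)
qed (simp add: field_autD[OF assms])

text \<open>Each automorphism sends a primitive element to one of its powers, hence acts on nonzero
  elements by a fixed exponent, and exponents commute.\<close>

lemma field_aut_commute:
  fixes \<rho> \<tau> :: "'a::{field, finite} \<Rightarrow> 'a"
  assumes "field_aut \<rho>" "field_aut \<tau>"
  shows "\<rho> (\<tau> x) = \<tau> (\<rho> x)"
proof (cases "x = 0")
  case False
  obtain g :: 'a where g: "g \<noteq> 0" "\<And>x. x \<noteq> 0 \<Longrightarrow> \<exists>i::nat. x = g ^ i"
    using finite_field_primitive_element[where 'a = 'a] by blast
  have "\<rho> g \<noteq> 0" "\<tau> g \<noteq> 0" using g(1) assms by (simp_all add: field_autD(8))
  with g(2) obtain i j k where "\<rho> g = g ^ i" "\<tau> g = g ^ j" "x = g ^ k"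
    using False by metis
  then show ?thesis
    using assms by (simp add: field_autD(7) flip: power_mult) (simp add: ac_simps)
qed (use assms in \<open>simp add: field_autD(5)\<close>)

lemma map_poly_aut_mult:
  assumes "field_aut \<rho>"
  shows "map_poly \<rho> (p * r) = map_poly \<rho> p * map_poly \<rho> r"
proof (rule poly_eqI)
  have sum: "\<rho> (sum f A) = (\<Sum>i\<in>A. \<rho> (f i))" for f :: "nat \<Rightarrow> 'a" and A
    by (induction A rule: infinite_finite_induct) (simp_all add: field_autD[OF assms])
  show "poly.coeff (map_poly \<rho> (p * r)) i = poly.coeff (map_poly \<rho> p * map_poly \<rho> r) i" for i
    by (simp add: coeff_map_poly field_autD[OF assms] coeff_mult sum)
qed

lemma map_poly_aut_prod:
  assumes "field_aut \<rho>"
  shows "map_poly \<rho> (\<Prod>i\<in>A. f i) = (\<Prod>i\<in>A. map_poly \<rho> (f i))"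
  by (induction A rule: infinite_finite_induct)
    (simp_all add: map_poly_aut_mult[OF assms] map_poly_1' field_autD[OF assms])

lemma poly_map_poly_aut:
  assumes "field_aut \<rho>"
  shows "poly (map_poly \<rho> p) (\<rho> x) = \<rho> (poly p x)"
  by (induction p) (simp_all add: map_poly_pCons field_autD[OF assms])

text \<open>Multiplication by a nonzero x permutes K - {0}; comparing the products of all elements
  gives x^(card K - 1) = 1.\<close>

lemma subfield_power_card:
  assumes K: "is_subfield K" and fin: "finite K" and x: "x \<in> K"
  shows "x ^ card K = x"
proof (cases "x = 0")
  case False
  have K_closed: "1 \<in> K" "\<And>x y. x \<in> K \<Longrightarrow> y \<in> K \<Longrightarrow> x * y \<in> K" "\<And>x. x \<in> K \<Longrightarrow> inverse x \<in> K" "0 \<in> K"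
    using K by (auto simp: is_subfield_def)
  have "(\<Prod>y\<in>K - {0}. x * y) = (\<Prod>y\<in>K - {0}. y)"
    by (rule prod.reindex_bij_witness[of _ "\<lambda>y. inverse x * y" "\<lambda>y. x * y"])
      (use False x K_closed in auto)
  then have "x ^ card (K - {0}) * (\<Prod>y\<in>K - {0}. y) = 1 * (\<Prod>y\<in>K - {0}. y)"
    by (simp add: prod.distrib)
  moreover have "(\<Prod>y\<in>K - {0}. y) \<noteq> 0"
    using fin by (simp add: prod_zero_iff)
  ultimately have "x ^ card (K - {0}) = 1" by (metis mult_right_cancel)
  moreover have "card K = Suc (card (K - {0}))"
    using fin K_closed(4) by (metis card.remove)
  ultimately show ?thesis by simp
next
  case True
  have "card K > 0" using K fin by (auto simp: is_subfield_def card_gt_0_iff)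
  then show ?thesis using True by simp
qed

text \<open>These are the roots of X^m - X, a nonzero polynomial of degree at most m.\<close>

lemma card_fixed_power:
  assumes "m \<ge> 2"
  shows "card {x::'a::field. x ^ m = x} \<le> m" and "finite {x::'a. x ^ m = x}"
proof -
  define p where "p = Polynomial.monom (1::'a) m - Polynomial.monom 1 1"
  have "poly.coeff p m = 1" using assms by (simp add: p_def)
  then have "p \<noteq> 0" by auto
  have "degree p \<le> m"
    unfolding p_def using assms by (intro degree_diff_le) (auto simp: degree_monom_eq)
  moreover have "{x. poly p x = 0} = {x. x ^ m = x}"
    by (simp add: p_def poly_monom)
  ultimately show "card {x::'a. x ^ m = x} \<le> m" "finite {x::'a. x ^ m = x}"
    using card_poly_roots_bound[OF \<open>p \<noteq> 0\<close>] poly_roots_finite[OF \<open>p \<noteq> 0\<close>] by auto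
qed

section \<open>The Galois group and its generation by the Frobenius map\<close>

locale finite_field_extension =
  fixes K :: "'a::{field, finite} set" and q n :: nat
  assumes primepow: "primepow q" and card_UNIV: "CARD('a) = q ^ n"
    and subfield: "is_subfield K" and card_K: "card K = q" and n_pos: "n > 0"
begin

lemma q_ge_2: "q \<ge> 2"
  using primepow by (simp add: primepow_gt_Suc_0 Suc_leI numeral_2_eq_2)

lemma prime_CHAR: "prime CHAR('a)"
  by (rule prime_CHAR_semidom) (simp add: finite_imp_CHAR_pos)

lemma q_CHAR_power: "\<exists>e. q = CHAR('a) ^ e"
proof -
  obtain p e where p: "prime p" "q = p ^ e"
    using primepow by (auto simp: primepow_def)
  have "CHAR('a) dvd p ^ (e * n)"
    using CHAR_dvd_CARD[where 'a = 'a] by (simp add: card_UNIV p power_mult)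
  then have "CHAR('a) dvd p" using prime_CHAR prime_dvd_power by blast
  then have "CHAR('a) = p" using prime_CHAR p(1) by (simp add: primes_dvd_imp_eq)
  then show ?thesis using p by blast
qed

lemma one_neq_minus_one:
  assumes "odd q"
  shows "(1::'a) \<noteq> - 1"
proof
  assume "(1::'a) = - 1"
  then have "of_nat 2 = (0::'a)" by (simp add: eq_neg_iff_add_eq_0)
  then have "CHAR('a) dvd 2" using of_nat_eq_0_iff_char_dvd by blast
  then have "CHAR('a) = 2" using prime_CHAR by (simp add: primes_dvd_imp_eq two_is_prime_nat)
  then obtain e where "q = 2 ^ e" using q_CHAR_power by auto
  then show False using assms q_ge_2 by (cases e) auto
qed

definition frob :: "nat \<Rightarrow> 'a \<Rightarrow> 'a" where
  "frob i x = x ^ q ^ i"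

lemma frob_0: "frob 0 x = x" and frob_comp: "frob i (frob j x) = frob (i + j) x"
  by (simp_all add: frob_def power_add mult.commute flip: power_mult)

lemma frob_n: "frob n x = x"
  using subfield_power_card[of UNIV x] by (simp add: frob_def is_subfield_def card_UNIV)

lemma frob_aut: "field_aut (frob i)"
proof -
  obtain e where e: "q = CHAR('a) ^ e" using q_CHAR_power by blast
  have add: "frob i (x + y) = frob i x + frob i y" for x y
    unfolding frob_def
    by (rule freshmans_dream'[OF prime_CHAR, of _ "e * i"]) (simp add: e power_mult)
  have "inj (frob i)"
  proof (rule injI)
    fix x y assume "frob i x = frob i y"
    then have "frob i (x - y) + frob i y = 0 + frob i y" by (simp flip: add)
    then have "frob i (x - y) = 0" by simp
    then show "x = y" by (simp add: frob_def)
  qed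
  then show ?thesis
    using add finite_UNIV_inj_surj[of "frob i"] unfolding field_aut_def bij_def
    by (simp add: frob_def power_mult_distrib)
qed

lemma frob_add_n_mult: "frob (i + n * m) x = frob i x"
proof (induction m)
  case (Suc m)
  have "frob (i + n * Suc m) x = frob (i + n * m) (frob n x)"
    by (simp add: frob_comp algebra_simps)
  then show ?case by (simp add: frob_n Suc)
qed simp

lemma frob_mod: "frob (i mod n) x = frob i x"
  using frob_add_n_mult[of "i mod n" "i div n" x] by simp

text \<open>If j = i mod n were positive, all q^n elements would be roots of X^(q^j) - X, although j
  < n.\<close>

lemma frob_eq_id_iff: "frob i = id \<longleftrightarrow> n dvd i"
proof
  assume "frob i = id"
  show "n dvd i"
  proof (rule ccontr)
    assume "\<not> n dvd i"
    then have pos: "0 < i mod n" and lt: "i mod n < n"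
      using n_pos by (auto simp: dvd_eq_mod_eq_0)
    have "frob (i mod n) x = x" for x
      using \<open>frob i = id\<close> by (simp add: frob_mod)
    then have "{x::'a. x ^ q ^ (i mod n) = x} = UNIV" by (simp add: frob_def)
    moreover have "q ^ (i mod n) \<ge> 2"
      using pos q_ge_2 by (metis One_nat_def Suc_leI le_trans power_increasing power_one_right
          one_le_numeral)
    ultimately have "q ^ n \<le> q ^ (i mod n)"
      using card_fixed_power(1)[of "q ^ (i mod n)", where 'a = 'a] by (simp add: card_UNIV)
    then show False using lt q_ge_2 by (simp add: power_increasing_iff)
  qed
next
  assume "n dvd i"
  then show "frob i = id" using frob_add_n_mult[of 0] by (auto simp: fun_eq_iff frob_0)
qed

lemma frob_eq_iff: "frob i = frob j \<longleftrightarrow> [i = j] (mod n)"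
proof -
  have *: "frob i = frob j \<longleftrightarrow> [i = j] (mod n)" if "i \<le> j" for i j
  proof -
    have "frob i = frob j \<longleftrightarrow> (\<forall>x. frob i x = frob i (frob (j - i) x))"
      using that by (simp add: frob_comp fun_eq_iff)
    also have "\<dots> \<longleftrightarrow> frob (j - i) = id"
      using bij_is_inj[OF field_autD(1)[OF frob_aut[of i]]] by (auto simp: inj_eq fun_eq_iff)
    also have "\<dots> \<longleftrightarrow> [i = j] (mod n)"
      using that by (simp add: frob_eq_id_iff cong_altdef_nat cong_sym_eq[of i])
    finally show ?thesis .
  qed
  show ?thesis using *[of i j] *[of j i] by (metis cong_sym nat_le_linear)
qed

text \<open>The fixed set contains K and has at most q elements, being the roots of X^q - X.\<close>

lemma K_eq: "K = {x. frob 1 x = x}"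
proof -
  have "K \<subseteq> {x. frob 1 x = x}"
    using subfield_power_card[OF subfield] by (auto simp: frob_def card_K)
  then show ?thesis
    using card_fixed_power[OF q_ge_2, where 'a = 'a]
    by (intro card_seteq) (simp_all add: frob_def card_K)
qed

lemma frob_in_Gal: "frob i \<in> Gal K"
proof -
  have "frob i x = x" if "x \<in> K" for x
  proof (induction i)
    case (Suc i)
    have "frob 1 x = x" using that by (subst (asm) K_eq) simp
    then show ?case using Suc frob_comp[of i 1 x] by simp
  qed (simp add: frob_0)
  then show ?thesis by (simp add: Gal_def frob_aut)
qed

text \<open>A primitive element g is a root of \<open>\<Prod>i<n. X - g ^ q ^ i\<close>, whose coefficients lie in K.\<close>
lemma Gal_eq: "Gal K = range frob"
proof
  show "range frob \<subseteq> Gal K" using frob_in_Gal by auto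
  show "Gal K \<subseteq> range frob"
  proof
    fix \<rho> assume "\<rho> \<in> Gal K"
    then have aut: "field_aut \<rho>" and fixed: "\<And>x. x \<in> K \<Longrightarrow> \<rho> x = x" by (auto simp: Gal_def)
    obtain g :: 'a where g: "g \<noteq> 0" "\<And>x. x \<noteq> 0 \<Longrightarrow> \<exists>i::nat. x = g ^ i"
      using finite_field_primitive_element[where 'a = 'a] by blast
    define F where "F i = [:- frob i g, 1:]" for i
    define p where "p = (\<Prod>i<n. F i)"
    have F: "map_poly (frob 1) (F i) = F (Suc i)" for i
      by (simp add: F_def map_poly_pCons field_autD[OF frob_aut] frob_comp)
    have "F n = F 0" by (simp add: F_def frob_n frob_0)
    \<comment> \<open>Frobenius sends \<open>F i\<close> to \<open>F (Suc i)\<close>, and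
      \<open>F n = F 0\<close>. The extra factor \<open>F 0\<close> expresses this cyclic shift and
      is cancelled afterwards.\<close>
    have "F 0 * map_poly (frob 1) p = F 0 * (\<Prod>i<n. F (Suc i))"
      by (simp add: p_def map_poly_aut_prod[OF frob_aut] F del: One_nat_def)
    also have "\<dots> = p * F n"
      unfolding p_def by (metis prod.lessThan_Suc prod.lessThan_Suc_shift)
    finally have "F 0 * map_poly (frob 1) p = F 0 * p"
      using \<open>F n = F 0\<close> by (simp add: mult.commute)
    moreover have "F 0 \<noteq> 0" by (simp add: F_def)
    ultimately have "map_poly (frob 1) p = p" by (metis mult_left_cancel)
    then have "frob 1 (poly.coeff p i) = poly.coeff p i" for i
      by (metis coeff_map_poly field_autD(5) frob_aut)
    then have "poly.coeff p i \<in> K" for i by (simp add: K_eq)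
    then have "map_poly \<rho> p = p"
      by (intro poly_eqI) (simp add: coeff_map_poly field_autD[OF aut] fixed)
    moreover have "poly p g = 0"
      unfolding p_def poly_prod using n_pos
      by (intro prod_zero bexI[of _ 0]) (simp_all add: F_def frob_0)
    ultimately have "poly p (\<rho> g) = 0"
      using poly_map_poly_aut[OF aut, of p g] by (simp add: field_autD[OF aut])
    \<comment> \<open>The roots of p are the Frobenius conjugates of g; an automorphism is
      determined by its value at g.\<close>
    then obtain i where "\<rho> g = frob i g"
      by (auto simp: p_def poly_prod F_def)
    have "\<rho> x = frob i x" for x
    proof (cases "x = 0")
      case False
      with g obtain j where "x = g ^ j" by blast
      then show ?thesis
        by (simp add: field_autD(7)[OF aut] field_autD(7)[OF frob_aut] \<open>\<rho> g = frob i g\<close>)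
    qed (simp add: field_autD(5)[OF aut] field_autD(5)[OF frob_aut])
    then show "\<rho> \<in> range frob" by auto
  qed
qed

lemma frob_funpow: "frob a ^^ m = frob (a * m)"
  by (induction m) (simp_all add: fun_eq_iff frob_0 frob_comp)

lemma inv_frob: "inv_into UNIV (frob a) = frob (a * (n - 1))"
proof (rule inv_unique_comp)
  have "a + a * (n - 1) = n * a" using n_pos by (cases n) simp_all
  then have "frob (a + a * (n - 1)) = id" by (simp add: frob_eq_id_iff)
  then show "frob a \<circ> frob (a * (n - 1)) = id" "frob (a * (n - 1)) \<circ> frob a = id"
    by (simp_all add: fun_eq_iff frob_comp add.commute)
qed

text \<open>The inverse of \<open>frob a\<close> is \<open>frob (a * (n - 1))\<close>, and n - 1 is
  congruent to -1 modulo n, so negative iterates obey the same formula.\<close>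

lemma int_iter_frob: "int_iter (frob a) i = frob (a * nat (i mod int n))"
proof -
  have "[a * m = a * nat (i mod int n)] (mod n)" if "[int m = i] (mod int n)" for m
  proof (rule cong_scalar_left)
    have "int m mod int n = i mod int n" using that by (simp add: cong_def)
    then have "m mod n = nat (i mod int n)" by (metis nat_int zmod_int)
    then show "[m = nat (i mod int n)] (mod n)" by (metis cong_mod_right cong_refl mod_mod_trivial cong_def)
  qed
  note * = this
  show ?thesis
  proof (cases "0 \<le> i")
    case True
    then show ?thesis
      using *[of "nat i"] by (simp add: int_iter_def frob_funpow frob_eq_iff)
  next
    case False
    have "[int ((n - 1) * nat (- i)) = i] (mod int n)"
    proof -
      have "int ((n - 1) * nat (- i)) - i = int n * (- i)"
        using False n_pos by (simp add: of_nat_diff algebra_simps)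
      then show ?thesis by (simp add: cong_iff_dvd_diff)
    qed
    from *[OF this] show ?thesis
      using False by (simp add: int_iter_def inv_frob frob_funpow frob_eq_iff mult.assoc)
  qed
qed

text \<open>Frobenius itself is an iterate of \<sigma>, which makes a invertible modulo n.\<close>

lemma generator_frob:
  assumes "generates_Gal K \<sigma>"
  obtains a where "\<sigma> = frob a" "coprime a n"
proof -
  obtain a where a: "\<sigma> = frob a" using assms by (auto simp: generates_Gal_def Gal_eq)
  have "frob 1 \<in> range (int_iter \<sigma>)"
    using assms frob_in_Gal[of 1] by (auto simp: generates_Gal_def)
  then obtain l where "frob 1 = int_iter \<sigma> l" by auto
  then have "[1 = a * nat (l mod int n)] (mod n)" by (simp only: a int_iter_frob frob_eq_iff)
  then have "[a * nat (l mod int n) = Suc 0] (mod n)" by (simp add: cong_sym)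
  then have "coprime a n" using coprime_iff_invertible_nat by blast
  with a show ?thesis by (rule that)
qed

lemma cyclic_automorphisms_int_iter:
  assumes gen: "generates_Gal K \<sigma>" and n: "n = 2 * t" "t \<ge> 5" and "odd q"
  shows "cyclic_automorphisms (int_iter \<sigma>) (int t)"
    and "int_iter \<sigma> (int t) x = x ^ q ^ t"
proof -
  obtain a where a: "\<sigma> = frob a" "coprime a n" by (rule generator_frob[OF gen])
  have mod_add: "[a * nat (i mod int n) + a * nat (j mod int n) = a * nat ((i + j) mod int n)] (mod n)" for i j
  proof -
    have "[nat (i mod int n) + nat (j mod int n) = nat ((i + j) mod int n)] (mod n)"
      using n_pos by (simp add: cong_int_iff[symmetric] cong_def mod_add_eq)
    then show ?thesis by (metis cong_scalar_left distrib_left)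
  qed
  have eq_iff: "int_iter \<sigma> i = int_iter \<sigma> j \<longleftrightarrow> [i = j] (mod int n)" for i j
  proof -
    have "int_iter \<sigma> i = int_iter \<sigma> j \<longleftrightarrow> [nat (i mod int n) = nat (j mod int n)] (mod n)"
      using a(2) by (simp add: a(1) int_iter_frob frob_eq_iff cong_mult_lcancel_nat)
    also have "\<dots> \<longleftrightarrow> [i = j] (mod int n)"
      using n_pos by (simp add: cong_int_iff[symmetric] cong_def)
    finally show ?thesis .
  qed
  note aut = field_autD[OF frob_aut]
  show "cyclic_automorphisms (int_iter \<sigma>) (int t)"
  proof
    show "int_iter \<sigma> i (int_iter \<sigma> j x) = int_iter \<sigma> (i + j) x" for i j x
      unfolding a(1) int_iter_frob frob_comp using mod_add[of i j] by (metis frob_eq_iff)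
    show "int_iter \<sigma> i = int_iter \<sigma> j \<longleftrightarrow> [i = j] (mod 2 * int t)" for i j
      using eq_iff by (simp add: n)
    show "int_iter \<sigma> i (x + y) = int_iter \<sigma> i x + int_iter \<sigma> i y"
      "int_iter \<sigma> i (x * y) = int_iter \<sigma> i x * int_iter \<sigma> i y" "int_iter \<sigma> i 1 = 1" for i x y
      by (simp_all only: a(1) int_iter_frob aut)
    show "int_iter \<sigma> 0 x = x" for x by (simp add: int_iter_def)
    show "5 \<le> int t" using n(2) by simp
    show "(1::'a) \<noteq> - 1" using \<open>odd q\<close> by (rule one_neq_minus_one)
  qed
  \<comment> \<open>As n = 2 * t is even, a is odd and a * t is congruent to t. Thus \<sigma>^t is
    x^(q^t) for every generator, which turns \<open>half_norm\<close> into x *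
    \<sigma>^t(x).\<close>
  have "odd a" using a(2) n by (auto simp: coprime_mult_right_iff)
  then obtain l where "a = 2 * l + 1" by (rule oddE)
  then have "[a * nat (int t mod int n) = t] (mod n)"
    using n by (simp add: cong_def algebra_simps)
  then have "frob (a * nat (int t mod int n)) = frob t" by (simp add: frob_eq_iff)
  then show "int_iter \<sigma> (int t) x = x ^ q ^ t" by (simp add: a(1) int_iter_frob frob_def)
qed

end


section \<open>Equivalence of the codes\<close>

lemma code_eq: "code h t \<tau> = {\<lambda>x. c * x + d * psi h t \<tau> x | c d. True}"
proof (intro equalityI subsetI)
  fix f assume "f \<in> code h t \<tau>"
  then obtain c d where "f - left_scale c id = left_scale d (psi h t \<tau>)"
    by (auto simp: code_def left.span_insert left.span_singleton)
  then have "f = (\<lambda>x. c * x + d * psi h t \<tau> x)"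
    by (simp add: fun_eq_iff left_scale_def diff_eq_eq add.commute)
  then show "f \<in> {\<lambda>x. c * x + d * psi h t \<tau> x | c d. True}" by blast
next
  fix f assume "f \<in> {\<lambda>x. c * x + d * psi h t \<tau> x | c d. True}"
  then obtain c d where f: "f = (\<lambda>x. c * x + d * psi h t \<tau> x)" by blast
  have "f = left_scale c id + left_scale d (psi h t \<tau>)"
    by (simp add: f fun_eq_iff left_scale_def)
  then show "f \<in> code h t \<tau>"
    unfolding code_def by (simp add: left.span_add left.span_scale left.span_base)
qed

context cyclic_automorphisms
begin

section \<open>The codes and their coefficient twists in the powers of \<sigma>\<close>

lemma field_aut_P: "field_aut (P i)"
  unfolding field_aut_def
  by (auto intro!: bij_betw_byWitness[where f' = "P (- i)"] simp: P_inv)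

lemma P_funpow: "P i ^^ m = P (i * int m)"
  by (induction m) (simp_all add: fun_eq_iff P_0 P_comp algebra_simps)

lemma psi_eq_quad:
  assumes t: "t = int t'" and "odd s"
  shows "psi h t' (P s) = quad s h"
proof
  fix x
  obtain l where l: "s = 2 * l + 1" using \<open>odd s\<close> by (rule oddE)
  have P_eqI: "P i x = P j x" if "i - j = 2 * t * d" for i j d
    using that by (intro P_cong) (simp add: cong_iff_dvd_diff)
  have inv: "inv_into UNIV (P s) = P (- s)"
    by (rule inv_unique_comp) (simp_all add: fun_eq_iff P_inv)
  have m: "int (t' - 1) = t - 1" "int (t' + 1) = t + 1" "int (2 * t' - 1) = 2 * t - 1"
    using t t_ge_5 by auto
  have "P (s * (t - 1)) x = P (t - s) x"
    by (rule P_eqI[of _ _ l]) (simp add: l algebra_simps)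
  moreover have "P (s * (t + 1)) x = P (t + s) x"
    by (rule P_eqI[of _ _ l]) (simp add: l algebra_simps)
  moreover have "P (s * (2 * t - 1)) x = P (- s) x"
    by (rule P_eqI[of _ _ s]) (simp add: algebra_simps)
  ultimately show "psi h t' (P s) x = quad s h x"
    unfolding psi_def quad_def P_funpow m inv by (simp add: divide_inverse)
qed

lemma sigma_poly_P: "sigma_poly m (P 1) a x = (\<Sum>i<m. a i * P (int i) x)"
  by (simp add: sigma_poly_def P_funpow)

lemma sigma_polys_add:
  assumes "f \<in> sigma_polys m \<sigma>" "g \<in> sigma_polys m \<sigma>"
  shows "(\<lambda>x. f x + g x) \<in> sigma_polys m \<sigma>"
proof -
  obtain a b where "f = sigma_poly m \<sigma> a" "g = sigma_poly m \<sigma> b"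
    using assms by (auto simp: sigma_polys_def)
  then have "(\<lambda>x. f x + g x) = sigma_poly m \<sigma> (\<lambda>i. a i + b i)"
    by (simp add: sigma_poly_def fun_eq_iff sum.distrib distrib_right)
  then show ?thesis by (simp add: sigma_polys_def)
qed

lemma monomial_in_sigma_polys:
  assumes "int m = 2 * t"
  shows "(\<lambda>x. c * P i x) \<in> sigma_polys m (P 1)"
proof -
  let ?j = "nat (i mod int m)"
  have "?j < m" using assms t_ge_5 by (simp add: nat_less_iff)
  have "c * P i x = sigma_poly m (P 1) (\<lambda>k. if k = ?j then c else 0) x" for x
  proof -
    have "P i x = P (int ?j) x"
      using assms t_ge_5 by (intro P_cong) (simp add: cong_def)
    moreover have "sigma_poly m (P 1) (\<lambda>k. if k = ?j then c else 0) x
        = (\<Sum>k<m. if k = ?j then c * P (int k) x else 0)"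
      unfolding sigma_poly_P by (intro sum.cong) auto
    ultimately show ?thesis using \<open>?j < m\<close> by (simp add: sum.delta)
  qed
  then have "(\<lambda>x. c * P i x) = sigma_poly m (P 1) (\<lambda>k. if k = ?j then c else 0)"
    by (simp add: fun_eq_iff)
  then show ?thesis by (auto simp: sigma_polys_def)
qed

lemma quad_in_sigma_polys:
  assumes "int m = 2 * t"
  shows "(\<lambda>x. c * x + d * quad s h x) \<in> sigma_polys m (P 1)"
proof -
  have eq: "(\<lambda>x. c * x + d * quad s h x) = (\<lambda>x. c * P 0 x + (d * P s x + (d * P (t - s) x
      + (d * (h * P s h) * P (t + s) x + d * (h / P (- s) h) * P (- s) x))))"
    by (simp add: quad_def P_0 fun_eq_iff algebra_simps)
  show ?thesis
    unfolding eq using assms by (intro sigma_polys_add monomial_in_sigma_polys)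
qed

lemma quad_aut:
  assumes w: "field_aut w" and comm: "\<And>i x. w (P i x) = P i (w x)"
  shows "w (quad s k x) = quad s (w k) (w x)"
  by (simp add: quad_def field_autD[OF w] field_aut_inverse[OF w] comm divide_inverse)

text \<open>In other words g^\<rho> = \<rho> o g o \<rho>^(-1): twisting coefficients is
  conjugation, because \<rho> commutes with \<sigma>.\<close>

lemma twisted_eq_conjugate:
  assumes \<rho>: "field_aut \<rho>" and comm: "\<And>i x. \<rho> (P i x) = P i (\<rho> x)"
  shows "sigma_poly m (P 1) (\<rho> \<circ> a) (\<rho> x) = \<rho> (sigma_poly m (P 1) a x)"
proof -
  have sum: "\<rho> (sum f A) = (\<Sum>i\<in>A. \<rho> (f i))" for f :: "nat \<Rightarrow> 'a" and A
    by (induction A rule: infinite_finite_induct) (simp_all add: field_autD[OF \<rho>])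
  show ?thesis by (simp add: sigma_poly_P sum field_autD[OF \<rho>] comm)
qed

text \<open>Conjugation by \<rho> turns the scalar c into \<rho> c and \<psi>_k into \<psi> for
  \<rho> k, so the twist is absorbed into the parameter.\<close>

lemma twisted_code:
  assumes m: "int m = 2 * t" and \<rho>: "field_aut \<rho>" and comm: "\<And>i x. \<rho> (P i x) = P i (\<rho> x)"
  shows "{sigma_poly m (P 1) (\<rho> \<circ> a) | a. sigma_poly m (P 1) a \<in> {\<lambda>x. c * x + d * quad s k x | c d. True}}
      = {\<lambda>x. c * x + d * quad s (\<rho> k) x | c d. True}"
    (is "?L = ?R")
proof -
  have key: "sigma_poly m (P 1) (\<rho> \<circ> a) = (\<lambda>x. \<rho> c * x + \<rho> d * quad s (\<rho> k) x)"
    if "sigma_poly m (P 1) a = (\<lambda>x. c * x + d * quad s k x)" for a c d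
  proof
    fix y
    obtain x where y: "y = \<rho> x"
      using field_autD(1)[OF \<rho>] by (metis bij_pointE)
    show "sigma_poly m (P 1) (\<rho> \<circ> a) y = \<rho> c * y + \<rho> d * quad s (\<rho> k) y"
      unfolding y twisted_eq_conjugate[OF \<rho> comm] that
      by (simp add: field_autD[OF \<rho>] quad_aut[OF \<rho> comm])
  qed
  show ?thesis
  proof (intro equalityI subsetI)
    fix f assume "f \<in> ?L"
    then show "f \<in> ?R" using key by blast
  next
    fix f assume "f \<in> ?R"
    then obtain c d where "f = (\<lambda>x. c * x + d * quad s (\<rho> k) x)" by blast
    moreover obtain c' d' where "c = \<rho> c'" "d = \<rho> d'"
      using field_autD(1)[OF \<rho>] by (metis bij_pointE)
    moreover obtain a where a: "sigma_poly m (P 1) a = (\<lambda>x. c' * x + d' * quad s k x)"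
      using quad_in_sigma_polys[OF m, of c' d' s k] by (auto simp: sigma_polys_def)
    ultimately have "f = sigma_poly m (P 1) (\<rho> \<circ> a)" using key[OF a] by simp
    then show "f \<in> ?L" using a by blast
  qed
qed

text \<open>Conjugation by f1 carries the scalars into the left idealiser of the first code, which
  consists of scalars only; hence f1 is a scalar multiple of a field automorphism.\<close>
lemma left_factor_semilinear:
  assumes h: "h * P t h = - 1"
    and C: "{\<lambda>x. c * x + d * quad 1 h x | c d. True}
      = {f1 \<circ> (\<lambda>x. c * x + d * quad s k x) \<circ> f2 | c d. True}"
    and f1: "bij f1" "\<And>x y. f1 (x + y) = f1 x + f1 y"
  shows "f1 1 \<noteq> 0" and "field_aut (\<lambda>x. f1 x / f1 1)"
proof -
  have scalar: "\<exists>u. \<forall>y. f1 (l * y) = u * f1 y" for l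
  proof -
    have mem: "\<exists>c d. \<forall>x. f1 (l * (\<alpha> * f2 x + \<beta> * quad s k (f2 x))) = c * x + d * quad 1 h x" for \<alpha> \<beta>
    proof -
      have "f1 \<circ> (\<lambda>x. (l * \<alpha>) * x + (l * \<beta>) * quad s k x) \<circ> f2
          \<in> {\<lambda>x. c * x + d * quad 1 h x | c d. True}"
        unfolding C by blast
      then obtain c d where "f1 \<circ> (\<lambda>x. (l * \<alpha>) * x + (l * \<beta>) * quad s k x) \<circ> f2
          = (\<lambda>x. c * x + d * quad 1 h x)" by blast
      then have "f1 (l * (\<alpha> * f2 x + \<beta> * quad s k (f2 x))) = c * x + d * quad 1 h x" for x
        by (simp add: fun_eq_iff distrib_left mult.assoc)
      then show ?thesis by blast
    qed
    \<comment> \<open>Since the identity lies in the first code, some (\<alpha> + \<beta> \<psi>_k)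
      o f2 is the inverse of f1. Scaling it by l shows that f1 o l o f1^(-1) = u + v
      \<psi>_h.\<close>
    have "(\<lambda>x. 1 * x + 0 * quad 1 h x) \<in> {f1 \<circ> (\<lambda>x. c * x + d * quad s k x) \<circ> f2 | c d. True}"
      unfolding C[symmetric] by blast
    then obtain \<alpha> \<beta>
      where "(\<lambda>x. 1 * x + 0 * quad 1 h x) = f1 \<circ> (\<lambda>x. \<alpha> * x + \<beta> * quad s k x) \<circ> f2"
      by blast
    then have id: "f1 (\<alpha> * f2 x + \<beta> * quad s k (f2 x)) = x" for x
      by (simp add: fun_eq_iff)
    have "(\<lambda>x. 0 * x + 1 * quad 1 h x) \<in> {f1 \<circ> (\<lambda>x. c * x + d * quad s k x) \<circ> f2 | c d. True}"
      unfolding C[symmetric] by blast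
    then obtain \<gamma> \<delta>
      where "(\<lambda>x. 0 * x + 1 * quad 1 h x) = f1 \<circ> (\<lambda>x. \<gamma> * x + \<delta> * quad s k x) \<circ> f2"
      by blast
    then have qd: "f1 (\<gamma> * f2 x + \<delta> * quad s k (f2 x)) = quad 1 h x" for x
      by (simp add: fun_eq_iff)
    obtain u v where uv: "\<And>x. f1 (l * (\<alpha> * f2 x + \<beta> * quad s k (f2 x))) = u * x + v * quad 1 h x"
      using mem by blast
    have uv': "f1 (l * y) = u * f1 y + v * quad 1 h (f1 y)" for y
    proof -
      have "\<alpha> * f2 (f1 y) + \<beta> * quad s k (f2 (f1 y)) = y"
        using id[of "f1 y"] bij_is_inj[OF f1(1)] by (simp add: inj_eq)
      then show ?thesis using uv[of "f1 y"] by simp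
    qed
    \<comment> \<open>Applied to the codeword \<psi>_h, the same conjugate gives u \<psi>_h + v
      (\<psi>_h o \<psi>_h), again in the first code.\<close>
    obtain c d where "\<And>x. f1 (l * (\<gamma> * f2 x + \<delta> * quad s k (f2 x))) = c * x + d * quad 1 h x"
      using mem by blast
    then have "u * quad 1 h x + v * quad 1 h (quad 1 h x) = c * x + d * quad 1 h x" for x
      by (simp add: uv' qd)
    then have "v = 0" by (rule quad_square_notin_span[OF h])
    then show ?thesis using uv' by auto
  qed
  have "f1 0 = 0" using f1(2)[of 0 0] by (simp only: add_0_right add_cancel_right_right)
  then show nz: "f1 1 \<noteq> 0" using bij_is_inj[OF f1(1)] by (metis injD zero_neq_one)
  \<comment> \<open>Setting y = 1 identifies u as f1 x / f1 1.\<close>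
  have mult: "f1 (x * y) / f1 1 = f1 x / f1 1 * (f1 y / f1 1)" for x y
  proof -
    obtain u where u: "\<And>y. f1 (x * y) = u * f1 y" using scalar by blast
    show ?thesis using u[of 1] u[of y] nz by simp
  qed
  have "bij (\<lambda>x. f1 x / f1 1)"
    using bij_comp[OF f1(1) bij_betw_byWitness[of UNIV "\<lambda>x. x * f1 1" "\<lambda>x. x / f1 1" UNIV]] nz
    by (simp add: comp_def)
  then show "field_aut (\<lambda>x. f1 x / f1 1)"
    using nz f1(2) mult by (simp add: field_aut_def add_divide_distrib)
qed

end

theorem corollary4p9:
  fixes K :: "'a::{field, finite} set" and \<sigma> :: "'a \<Rightarrow> 'a" and h k :: 'a
    and q n t :: nat and s :: int
  assumes "primepow q" and "odd q"
    and "n = 2 * t" and "t \<ge> 5"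
    and "CARD('a) = q ^ n"
    and "is_subfield K" and "card K = q"
    and "generates_Gal K \<sigma>"
    and "half_norm q t h = - 1" and "half_norm q t k = - 1"
    and "coprime s (int n)"
    and "\<forall>r\<in>{1, - 1, int t - 1, int t + 1}. \<not> [s = r] (mod int n)"
  shows "\<not> codes_equivalent n \<sigma> (code h t \<sigma>) (code k t (int_iter \<sigma> s))"
proof
  interpret finite_field_extension K q n
    using assms by unfold_locales auto
  interpret cyclic_automorphisms "int_iter \<sigma>" "int t"
    by (rule cyclic_automorphisms_int_iter) (use assms in auto)
  let ?P = "int_iter \<sigma>" and ?T = "int t"
  have norm: "x * ?P ?T x = - 1" if "half_norm q t x = - 1" for x
    using that cyclic_automorphisms_int_iter(2)[OF assms(8,3,4,2), of x] by (simp add: half_norm_def)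
  have \<sigma>: "?P 1 = \<sigma>" by (simp add: int_iter_def)
  have m: "int n = 2 * ?T" using assms(3) by simp
  have "odd s" using assms(3,11) by (auto simp: coprime_mult_right_iff)
  have code_h: "code h t \<sigma> = {\<lambda>x. c * x + d * quad 1 h x | c d. True}"
    using psi_eq_quad[of t 1 h] by (simp add: code_eq \<sigma>)
  have code_k: "code k t (?P s) = {\<lambda>x. c * x + d * quad s k x | c d. True}"
    using psi_eq_quad[of t s k] \<open>odd s\<close> by (simp add: code_eq)
  assume "codes_equivalent n \<sigma> (code h t \<sigma>) (code k t (?P s))"
  then obtain f1 f2 \<rho> where f1: "invertible_poly n \<sigma> f1" and f2: "invertible_poly n \<sigma> f2"
    and \<rho>: "field_aut \<rho>"
    and C: "code h t \<sigma> = {f1 \<circ> sigma_poly n \<sigma> (\<rho> \<circ> a) \<circ> f2 | a. sigma_poly n \<sigma> a \<in> code k t (?P s)}"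
    unfolding codes_equivalent_def by blast
  have comm: "w (?P i x) = ?P i (w x)" if "field_aut w" for w i x
    by (rule field_aut_commute[OF that field_aut_P])
  have bij: "bij f" if "invertible_poly n \<sigma> f" for f
    using that by (auto simp: invertible_poly_def intro: o_bij)
  have add: "f1 (x + y) = f1 x + f1 y" for x y
  proof -
    obtain a where "f1 = sigma_poly n (?P 1) a"
      using f1 by (auto simp: invertible_poly_def sigma_polys_def \<sigma>)
    then show ?thesis by (simp add: sigma_poly_P distrib_left sum.distrib)
  qed
  have "code h t \<sigma> = (\<lambda>g. f1 \<circ> g \<circ> f2) ` {sigma_poly n \<sigma> (\<rho> \<circ> a) | a. sigma_poly n \<sigma> a \<in> code k t (?P s)}"
    unfolding C by auto
  also have "{sigma_poly n \<sigma> (\<rho> \<circ> a) | a. sigma_poly n \<sigma> a \<in> code k t (?P s)}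
      = {\<lambda>x. c * x + d * quad s (\<rho> k) x | c d. True}"
    using twisted_code[OF m \<rho> comm[OF \<rho>], of s k] by (simp only: \<sigma> code_k)
  also have "(\<lambda>g. f1 \<circ> g \<circ> f2) ` {\<lambda>x. c * x + d * quad s (\<rho> k) x | c d. True}
      = {f1 \<circ> (\<lambda>x. c * x + d * quad s (\<rho> k) x) \<circ> f2 | c d. True}"
    by blast
  finally have C': "{\<lambda>x. c * x + d * quad 1 h x | c d. True}
      = {f1 \<circ> (\<lambda>x. c * x + d * quad s (\<rho> k) x) \<circ> f2 | c d. True}"
    unfolding code_h .
  define w where "w x = f1 x / f1 1" for x
  have nz: "f1 1 \<noteq> 0" and w: "field_aut w"
    using left_factor_semilinear[OF norm[OF assms(9)] C' bij[OF f1] add] by (simp_all add: w_def[abs_def])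
  have f1_w: "f1 x = f1 1 * w x" for x using nz by (simp add: w_def)
  define f where "f x = w (f2 x)" for x
  \<comment> \<open>Multiplication by \<alpha> absorbs the factor \<open>f1 1\<close>: f1 (\<alpha>
    * y) = w y.\<close>
  obtain \<alpha> where "f1 \<alpha> = 1" using bij[OF f1] by (metis bij_pointE)
  then have \<alpha>: "f1 1 * w \<alpha> = 1" by (simp flip: f1_w)
  have mem: "\<exists>a b. \<forall>x. f1 (c * f2 x + d * quad s (\<rho> k) (f2 x)) = a * x + b * quad 1 h x" for c d
  proof -
    have "f1 \<circ> (\<lambda>x. c * x + d * quad s (\<rho> k) x) \<circ> f2 \<in> {\<lambda>x. c * x + d * quad 1 h x | c d. True}"
      unfolding C' by blast
    then obtain a b where "f1 \<circ> (\<lambda>x. c * x + d * quad s (\<rho> k) x) \<circ> f2 = (\<lambda>x. a * x + b * quad 1 h x)"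
      by blast
    then have "f1 (c * f2 x + d * quad s (\<rho> k) (f2 x)) = a * x + b * quad 1 h x" for x
      by (simp add: fun_eq_iff)
    then show ?thesis by blast
  qed
  have f1_\<alpha>: "f1 (\<alpha> * y) = w y" for y
    unfolding f1_w[of "\<alpha> * y"] field_autD(4)[OF w] mult.assoc[symmetric] \<alpha> by simp
  \<comment> \<open>The codewords \<alpha> and \<alpha> \<psi> of the twisted second code give
    \<open>ab\<close> and \<open>cd\<close>; moving w inside \<psi> replaces the parameter \<rho> k
    by w (\<rho> k).\<close>
  obtain a b where "\<And>x. f1 (\<alpha> * f2 x + 0 * quad s (\<rho> k) (f2 x)) = a * x + b * quad 1 h x"
    using mem[of \<alpha> 0] by blast
  then have ab: "f x = a * x + b * quad 1 h x" for x
    by (simp add: f1_\<alpha> f_def)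
  obtain c d where "\<And>x. f1 (0 * f2 x + \<alpha> * quad s (\<rho> k) (f2 x)) = c * x + d * quad 1 h x"
    using mem[of 0 \<alpha>] by blast
  then have cd: "w (quad s (\<rho> k) (f2 x)) = c * x + d * quad 1 h x" for x
    by (simp add: f1_\<alpha>)
  have "bij f"
    using bij_comp[OF bij[OF f2] field_autD(1)[OF w]] by (simp add: f_def[abs_def] comp_def)
  show False
  proof (rule quad_exclusion)
    show "quad s (w (\<rho> k)) (a * x + b * quad 1 h x) = c * x + d * quad 1 h x" for x
      using cd[of x] by (simp add: quad_aut[OF w comm[OF w]] flip: ab) (simp add: f_def)
    show "surj (\<lambda>x. a * x + b * quad 1 h x)"
      using bij_is_surj[OF \<open>bij f\<close>] by (simp add: ab[abs_def])
    \<comment> \<open>Both w and \<rho> fix -1 and commute with \<sigma>, so the norm condition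
      passes from k to w (\<rho> k).\<close>
    have "w (\<rho> (k * ?P ?T k)) = - 1"
      by (simp only: norm[OF assms(10)]) (simp add: field_autD[OF \<rho>] field_autD[OF w])
    then show "w (\<rho> k) * ?P ?T (w (\<rho> k)) = - 1"
      by (simp add: field_autD(4)[OF \<rho>] field_autD(4)[OF w] comm[OF \<rho>] comm[OF w])
  qed (use assms(11,12) norm[OF assms(9)] in \<open>simp_all add: m\<close>)
qed

end
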